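(* Let $F$ be a field of any characteristic with $-1\in(F^\times)^2$, let $k\ge1$ be an integer, and let $\psi_1$ and $\psi_2$ be $(k+1)$-linked quadratic Pfister forms over $F$. Then their $k$-invariant is trivial, i.e., $\mathcal{F}_k(\psi_1,\psi_2)$ is hyperbolic.
   Context: Equality of forms means isometry. For $a\in F^\times$, $\langle\langle a\rangle\rangle$ denotes the symmetric bilinear form $\langle 1,-a\rangle$, and an $r$-fold bilinear Pfister form is $\langle\langle a_1,\dots,a_r\rangle\rangle=\langle\langle a_1\rangle\rangle\otimes\cdots\otimes\langle\langle a_r\rangle\rangle$ with $a_i\in F^\times$ (the $0$-fold one is $\langle 1\rangle$). For a diagonal bilinear form $B=\langle b_1,\dots,b_s\rangle$ and a quadratic form $q$, $B\otimes q = b_1q\perp\cdots\perp b_sq$. For $n\ge1$, an $n$-fold quadratic Pfister form is: if $\operatorname{char}F\ne2$, the $2^n$-dimensional quadratic form $\langle\langle\alpha_1,\dots,\alpha_n\rangle\rangle=\perp_{c_1,\dots,c_n\in\{0,1\}}\langle(-1)^{c_1+\cdots+c_n}\alpha_1^{c_1}\cdots\alpha_n^{c_n}\rangle$ with $\alpha_i\in F^\times$; if $\operatorname{char}F=2$, the form $\langle\langle\alpha_1,\dots,\alpha_{n-1},\alpha_n]]=\langle\langle\alpha_1,\dots,\alpha_{n-1}\rangle\rangle\otimes[1,\alpha_n]$ with $\alpha_1,\dots,\alpha_{n-1}\in F^\times$, $\alpha_n\in F$, where $[1,\alpha]$ is the quadratic form $x^2+xy+\alpha y^2$. For an integer $j\ge1$,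 quadratic Pfister forms $\psi_1,\psi_2$ are $j$-linked (i.e. separably $j$-linked) if there are a $j$-fold quadratic Pfister form $\pi$ and bilinear Pfister forms $B_1,B_2$ with $\psi_1=B_1\otimes\pi$ and $\psi_2=B_2\otimes\pi$; $(k+1)$-linked forms are in particular $k$-linked. For $k$-linked $\psi_1,\psi_2$, the $k$-invariant is the quadratic Pfister form $\mathcal{F}_k(\psi_1,\psi_2)=\varphi_1\otimes\varphi_2\otimes\pi$, where $\pi$ is any $k$-fold quadratic Pfister form and $\varphi_1,\varphi_2$ any bilinear Pfister forms with $\psi_1=\varphi_1\otimes\pi$, $\psi_2=\varphi_2\otimes\pi$; up to isometry it does not depend on these choices. *)

theory Defs
  imports
    "Jordan_Normal_Form.Matrix"
    "HOL-Computational_Algebra.Computational_Algebra"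
begin

text \<open>
  A square matrix \<open>A\<close> of size \<open>n\<close> over a field \<open>F\<close> stands for the quadratic form
  \<open>x \<mapsto> x\<^sup>T A x\<close> on \<open>F\<^sup>n\<close>.  The matrix is not required to be symmetric: over a field of
  characteristic two symmetric matrices do not represent all quadratic forms.  Different matrices
  may represent the same form; isometry only refers to the values.
\<close>

definition qf_value :: "'a::field mat \<Rightarrow> 'a vec \<Rightarrow> 'a" where
  "qf_value A x = x \<bullet> (A *\<^sub>v x)"

definition isometric :: "'a::field mat \<Rightarrow> 'a mat \<Rightarrow> bool" where
  "isometric A B \<longleftrightarrow> (\<exists>n P. A \<in> carrier_mat n n \<and> B \<in> carrier_mat n n \<and>
     P \<in> carrier_mat n n \<and> invertible_mat P \<and>
     (\<forall>x\<in>carrier_vec n. qf_value A (P *\<^sub>v x) = qf_value B x))"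

text \<open>Orthogonal sums are block diagonal matrices, \<open>diag_block_mat\<close>.\<close>

definition hyperbolic_plane :: "'a::field mat" where
  "hyperbolic_plane = mat_of_rows_list 2 [[0, 1], [0, 0]]"

definition hyperbolic :: "'a::field mat \<Rightarrow> bool" where
  "hyperbolic A \<longleftrightarrow> (\<exists>m. isometric A (diag_block_mat (replicate m hyperbolic_plane)))"

text \<open>
  The diagonal bilinear form \<open>\<langle>b\<^sub>1,\<dots>,b\<^sub>s\<rangle>\<close> is given by the list \<open>[b\<^sub>1,\<dots>,b\<^sub>s]\<close>.
  Up to isometry every bilinear Pfister form is of this kind, and the isometry class of \<open>B \<otimes> q\<close>
  depends only on those of \<open>B\<close> and \<open>q\<close>, so diagonal lists suffice for all products below.
\<close>

definition bilin_tensor :: "'a::field list \<Rightarrow> 'a list \<Rightarrow> 'a list" where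
  "bilin_tensor B C = [b * c. b \<leftarrow> B, c \<leftarrow> C]"

definition bilin_quad_tensor :: "'a::field list \<Rightarrow> 'a mat \<Rightarrow> 'a mat" where
  "bilin_quad_tensor B A = diag_block_mat (map (\<lambda>b. b \<cdot>\<^sub>m A) B)"

fun pfister_diag :: "'a::field list \<Rightarrow> 'a list" where
  "pfister_diag [] = [1]"
| "pfister_diag (a # as) = bilin_tensor [1, - a] (pfister_diag as)"

definition bilinear_pfister :: "'a::field list \<Rightarrow> bool" where
  "bilinear_pfister B \<longleftrightarrow> (\<exists>as. 0 \<notin> set as \<and> B = pfister_diag as)"

definition diag_quad :: "'a::field list \<Rightarrow> 'a mat" where
  "diag_quad bs = diag_block_mat (map (\<lambda>b. mat_of_rows_list 1 [[b]]) bs)"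

text \<open>\<open>binary_quad a\<close> is the form \<open>[1, a]\<close>, that is, \<open>x\<^sup>2 + x y + a y\<^sup>2\<close>.\<close>

definition binary_quad :: "'a::field \<Rightarrow> 'a mat" where
  "binary_quad a = mat_of_rows_list 2 [[1, 1], [0, a]]"

text \<open>
  The entries of \<open>pfister_diag [a\<^sub>1,\<dots>,a\<^sub>n]\<close> are the products
  \<open>(-1)\<^bsup>c\<^sub>1+\<dots>+c\<^sub>n\<^esup> a\<^sub>1\<^bsup>c\<^sub>1\<^esup>\<cdots>a\<^sub>n\<^bsup>c\<^sub>n\<^esup>\<close> for \<open>c\<^sub>i \<in> {0, 1}\<close>.
  Equality of forms means isometry, so the class of Pfister forms is closed under isometry.
\<close>

definition quadratic_pfister :: "nat \<Rightarrow> 'a::field mat \<Rightarrow> bool" where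
  "quadratic_pfister n Q \<longleftrightarrow> n \<ge> 1 \<and>
     (if CHAR('a) = 2
      then \<exists>as b. length as = n - 1 \<and> 0 \<notin> set as \<and>
             isometric Q (bilin_quad_tensor (pfister_diag as) (binary_quad b))
      else \<exists>as. length as = n \<and> 0 \<notin> set as \<and> isometric Q (diag_quad (pfister_diag as)))"

definition common_factor ::
  "nat \<Rightarrow> 'a::field mat \<Rightarrow> 'a mat \<Rightarrow> 'a mat \<Rightarrow> 'a list \<Rightarrow> 'a list \<Rightarrow> bool" where
  "common_factor j Q1 Q2 P B1 B2 \<longleftrightarrow>
     quadratic_pfister j P \<and> bilinear_pfister B1 \<and> bilinear_pfister B2 \<and>
     isometric Q1 (bilin_quad_tensor B1 P) \<and> isometric Q2 (bilin_quad_tensor B2 P)"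

definition linked :: "nat \<Rightarrow> 'a::field mat \<Rightarrow> 'a mat \<Rightarrow> bool" where
  "linked j Q1 Q2 \<longleftrightarrow> (\<exists>P B1 B2. common_factor j Q1 Q2 P B1 B2)"

text \<open>
  The invariant \<open>\<F>\<^sub>k(Q1, Q2)\<close> is an isometry class; \<open>is_k_invariant k Q1 Q2 R\<close> says that \<open>R\<close>
  represents it, for some choice of the common factor and the cofactors.
\<close>

definition is_k_invariant :: "nat \<Rightarrow> 'a::field mat \<Rightarrow> 'a mat \<Rightarrow> 'a mat \<Rightarrow> bool" where
  "is_k_invariant k Q1 Q2 R \<longleftrightarrow> (\<exists>P B1 B2. common_factor k Q1 Q2 P B1 B2 \<and>
     isometric R (bilin_quad_tensor (bilin_tensor B1 B2) P))"

end

theory Submission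
  imports Defs "Jordan_Normal_Form.Determinant"
begin

text \<open>
  Write \<open>\<psi>\<^sub>1 = \<phi>\<^sub>1 \<otimes> P = C\<^sub>1 \<otimes> Q\<close> and \<open>\<psi>\<^sub>2 = \<phi>\<^sub>2 \<otimes> P = C\<^sub>2 \<otimes> Q\<close>, where \<open>P\<close> is an arbitrary common
  \<open>k\<close>-fold factor and \<open>Q\<close> is a common \<open>(k + 1)\<close>-fold factor. No relation between \<open>P\<close> and \<open>Q\<close> is
  known, and the argument avoids finding one: it does not show first that the invariant is
  independent of \<open>P\<close>.

  The invariant \<open>\<phi>\<^sub>1 \<otimes> \<phi>\<^sub>2 \<otimes> P\<close> is again a quadratic Pfister form, and an isotropic quadratic Pfister
  form is hyperbolic. So a single nontrivial zero suffices. If \<open>i\<^sup>2 = -1\<close>, then \<open>\<psi>\<^sub>1 \<perp> \<psi>\<^sub>2\<close> has the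
  totally isotropic subspace \<open>{(x, i x)}\<close>, with \<open>x\<close> in the copies of \<open>Q\<close> inside \<open>C\<^sub>1 \<otimes> Q\<close> and
  \<open>C\<^sub>2 \<otimes> Q\<close>. Its dimension \<open>2\<^bsup>k+1\<^esup>\<close> exceeds \<open>dim P = 2\<^sup>k\<close>, so it meets the subspace
  \<open>\<phi>\<^sub>1 \<otimes> P \<perp> \<phi>\<^sub>2' \<otimes> P\<close>, where \<open>\<phi>\<^sub>2 = 1 \<perp> \<phi>\<^sub>2'\<close>. Since \<open>\<phi>\<^sub>1 = 1 \<perp> \<phi>\<^sub>1'\<close>, the product
  \<open>\<phi>\<^sub>1 \<otimes> \<phi>\<^sub>2 = 1 \<perp> \<phi>\<^sub>1' \<perp> \<phi>\<^sub>2' \<perp> \<phi>\<^sub>1' \<otimes> \<phi>\<^sub>2'\<close> contains \<open>\<phi>\<^sub>1 \<perp> \<phi>\<^sub>2'\<close>, and the zero lies in the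
  invariant. This is \<open>tensor_isotropic_of_large_common_part\<close>.

  That isotropic Pfister forms are hyperbolic is \<open>quadratic_pfister_isotropic_imp_hyperbolic\<close>. In
  every characteristic a quadratic Pfister form is obtained from a binary norm form
  \<open>x\<^sup>2 + s x y + a y\<^sup>2\<close> of nonzero discriminant by repeatedly passing from \<open>A\<close> to \<open>A \<perp> -a A\<close>, and this
  doubling preserves roundness, the implication from isotropy to hyperbolicity, and hyperbolicity of
  \<open>A \<perp> -A\<close>. Working with an arbitrary \<open>s\<close> avoids a separate treatment of characteristic two.

  Existence of the invariant means that \<open>(k + 1)\<close>-linked forms are \<open>k\<close>-linked: one bilinear slot of
  \<open>Q\<close> is moved into the cofactors.
\<close>

section \<open>Isometry\<close>

text \<open>
  Linear substitutions are handled below through their kernels: an explicit inverse never has to be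
  written down.
\<close>

lemma invertible_mat_iff_kernel_zero:
  fixes P :: "'a::field mat"
  assumes P: "P \<in> carrier_mat n n"
  shows "invertible_mat P \<longleftrightarrow> (\<forall>x\<in>carrier_vec n. P *\<^sub>v x = 0\<^sub>v n \<longrightarrow> x = 0\<^sub>v n)"
proof
  assume "invertible_mat P"
  then obtain B where B: "P * B = 1\<^sub>m n" "B * P = 1\<^sub>m (dim_row B)"
    using P unfolding invertible_mat_def inverts_mat_def by auto
  have Bc: "B \<in> carrier_mat n n"
    using B P by (metis carrier_matD carrier_matI index_mult_mat(2,3) index_one_mat(2,3))
  show "\<forall>x\<in>carrier_vec n. P *\<^sub>v x = 0\<^sub>v n \<longrightarrow> x = 0\<^sub>v n"
  proof (intro ballI impI)
    fix x :: "'a vec" assume x: "x \<in> carrier_vec n" and 0: "P *\<^sub>v x = 0\<^sub>v n"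
    have "x = (B * P) *\<^sub>v x" using B Bc x by simp
    also have "\<dots> = B *\<^sub>v (P *\<^sub>v x)" using Bc P x by (simp add: assoc_mult_mat_vec)
    also have "\<dots> = 0\<^sub>v n" using Bc 0 by auto
    finally show "x = 0\<^sub>v n" .
  qed
next
  assume "\<forall>x\<in>carrier_vec n. P *\<^sub>v x = 0\<^sub>v n \<longrightarrow> x = 0\<^sub>v n"
  then have "det P \<noteq> 0" using det_0_iff_vec_prod_zero_field[OF P] by blast
  from det_non_zero_imp_unit[OF P this]
  obtain B where "B \<in> carrier_mat n n" "B * P = 1\<^sub>m n" "P * B = 1\<^sub>m n"
    unfolding Units_def ring_mat_def by auto
  then show "invertible_mat P"
    using P unfolding invertible_mat_def inverts_mat_def by auto
qed

lemma isometricI: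
  assumes "A \<in> carrier_mat n n" "B \<in> carrier_mat n n" "P \<in> carrier_mat n n"
    and "\<And>x. x \<in> carrier_vec n \<Longrightarrow> P *\<^sub>v x = 0\<^sub>v n \<Longrightarrow> x = 0\<^sub>v n"
    and "\<And>x. x \<in> carrier_vec n \<Longrightarrow> qf_value A (P *\<^sub>v x) = qf_value B x"
  shows "isometric A B"
  using assms unfolding isometric_def invertible_mat_iff_kernel_zero[OF assms(3)]
  by (metis invertible_mat_iff_kernel_zero)

lemma isometricE:
  assumes "isometric A B"
  obtains n P where "A \<in> carrier_mat n n" "B \<in> carrier_mat n n" "P \<in> carrier_mat n n"
    and "\<And>x. x \<in> carrier_vec n \<Longrightarrow> P *\<^sub>v x = 0\<^sub>v n \<Longrightarrow> x = 0\<^sub>v n"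
    and "\<And>x. x \<in> carrier_vec n \<Longrightarrow> qf_value A (P *\<^sub>v x) = qf_value B x"
  using assms unfolding isometric_def by (metis invertible_mat_iff_kernel_zero)

lemma isometric_refl: "A \<in> carrier_mat n n \<Longrightarrow> isometric A A"
  by (rule isometricI[where P = "1\<^sub>m n"]) auto

lemma isometric_sym:
  assumes "isometric A B"
  shows "isometric B A"
proof -
  from assms obtain n P where A: "A \<in> carrier_mat n n" and B: "B \<in> carrier_mat n n"
    and P: "P \<in> carrier_mat n n" and inv: "invertible_mat P"
    and val: "\<And>x. x \<in> carrier_vec n \<Longrightarrow> qf_value A (P *\<^sub>v x) = qf_value B x"
    unfolding isometric_def by blast
  from inv obtain R where R: "P * R = 1\<^sub>m n" "R * P = 1\<^sub>m (dim_row R)"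
    using P unfolding invertible_mat_def inverts_mat_def by auto
  have Rc: "R \<in> carrier_mat n n"
    using R P by (metis carrier_matD carrier_matI index_mult_mat(2,3) index_one_mat(2,3))
  have PR: "P *\<^sub>v (R *\<^sub>v x) = x" if "x \<in> carrier_vec n" for x
    using that P Rc R by (metis assoc_mult_mat_vec one_mult_mat_vec)
  show ?thesis
  proof (rule isometricI[OF B A Rc])
    fix x :: "'a vec" assume x: "x \<in> carrier_vec n"
    have Rx: "R *\<^sub>v x \<in> carrier_vec n" using Rc x by auto
    show "qf_value B (R *\<^sub>v x) = qf_value A x" using val[OF Rx] PR[OF x] by simp
    show "x = 0\<^sub>v n" if "R *\<^sub>v x = 0\<^sub>v n"
      using PR[OF x] that P by auto
  qed
qed

lemma isometric_trans [trans]: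
  assumes "isometric A B" "isometric B C"
  shows "isometric A C"
proof -
  from assms(1) obtain n P where A: "A \<in> carrier_mat n n" "B \<in> carrier_mat n n"
    and P: "P \<in> carrier_mat n n"
    and kP: "\<And>x. x \<in> carrier_vec n \<Longrightarrow> P *\<^sub>v x = 0\<^sub>v n \<Longrightarrow> x = 0\<^sub>v n"
    and vP: "\<And>x. x \<in> carrier_vec n \<Longrightarrow> qf_value A (P *\<^sub>v x) = qf_value B x"
    by (rule isometricE) blast
  from assms(2) obtain m R where B: "B \<in> carrier_mat m m" "C \<in> carrier_mat m m"
    and R: "R \<in> carrier_mat m m"
    and kR: "\<And>x. x \<in> carrier_vec m \<Longrightarrow> R *\<^sub>v x = 0\<^sub>v m \<Longrightarrow> x = 0\<^sub>v m"
    and vR: "\<And>x. x \<in> carrier_vec m \<Longrightarrow> qf_value B (R *\<^sub>v x) = qf_value C x"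
    by (rule isometricE) blast
  have [simp]: "m = n" using A B by auto
  have Rx: "R *\<^sub>v x \<in> carrier_vec n" if "x \<in> carrier_vec n" for x using that R by auto
  have PRx: "(P * R) *\<^sub>v x = P *\<^sub>v (R *\<^sub>v x)" if "x \<in> carrier_vec n" for x
    using that P R by (simp add: assoc_mult_mat_vec)
  show ?thesis
  proof (rule isometricI[where P = "P * R" and n = n])
    fix x :: "'a vec" assume x: "x \<in> carrier_vec n"
    show "qf_value A (P * R *\<^sub>v x) = qf_value C x"
      using vP[OF Rx[OF x]] vR[of x] x PRx by simp
    show "x = 0\<^sub>v n" if "P * R *\<^sub>v x = 0\<^sub>v n"
      using kP[OF Rx[OF x]] kR[of x] x PRx that by simp
  qed (use A B P R in auto)
qed

lemma isometric_dims:
  assumes "isometric A B" "A \<in> carrier_mat n n"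
  shows "B \<in> carrier_mat n n"
  using assms unfolding isometric_def by auto

lemma qf_value_smult:
  assumes "A \<in> carrier_mat n n" "x \<in> carrier_vec n"
  shows "qf_value (c \<cdot>\<^sub>m A) x = c * qf_value A x"
proof -
  have "(c \<cdot>\<^sub>m A) *\<^sub>v x = c \<cdot>\<^sub>v (A *\<^sub>v x)" using assms by (intro eq_vecI) auto
  then show ?thesis using assms unfolding qf_value_def by simp
qed

lemma qf_value_smult_vec:
  assumes "A \<in> carrier_mat n n" "x \<in> carrier_vec n"
  shows "qf_value A (c \<cdot>\<^sub>v x) = c\<^sup>2 * qf_value A x"
proof -
  have "A *\<^sub>v (c \<cdot>\<^sub>v x) = c \<cdot>\<^sub>v (A *\<^sub>v x)" using assms by (simp add: mult_mat_vec)
  then show ?thesis using assms unfolding qf_value_def by (simp add: power2_eq_square)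
qed

lemma qf_value_zero [simp]: "A \<in> carrier_mat n n \<Longrightarrow> qf_value A (0\<^sub>v n) = 0"
  unfolding qf_value_def by (simp add: scalar_prod_left_zero[of _ n])

lemma qf_value_add:
  assumes "A \<in> carrier_mat n n" "x \<in> carrier_vec n" "y \<in> carrier_vec n"
  shows "qf_value A (x + y) = qf_value A x + (x \<bullet> (A *\<^sub>v y) + y \<bullet> (A *\<^sub>v x)) + qf_value A y"
proof -
  have [simp]: "A *\<^sub>v x \<in> carrier_vec n" "A *\<^sub>v y \<in> carrier_vec n" using assms by auto
  show ?thesis using assms unfolding qf_value_def
    by (simp add: mult_add_distrib_mat_vec[OF assms] scalar_prod_add_distrib[of _ n]
        add_scalar_prod_distrib[of _ n])
qed

section \<open>Orthogonal sums\<close>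

definition orth_sum :: "'a::field mat \<Rightarrow> 'a mat \<Rightarrow> 'a mat" where
  "orth_sum A B =
     four_block_mat A (0\<^sub>m (dim_row A) (dim_col B)) (0\<^sub>m (dim_row B) (dim_col A)) B"

lemma orth_sum_carrier [simp]:
  "A \<in> carrier_mat n n \<Longrightarrow> B \<in> carrier_mat m m \<Longrightarrow> orth_sum A B \<in> carrier_mat (n + m) (n + m)"
  unfolding orth_sum_def by auto

lemma diag_block_mat_append_orth_sum:
  "diag_block_mat (As @ Bs) = orth_sum (diag_block_mat As) (diag_block_mat Bs)"
  unfolding orth_sum_def diag_block_mat_append Let_def ..

lemma diag_block_mat_Cons_orth_sum:
  "diag_block_mat (A # As) = orth_sum A (diag_block_mat As)"
  unfolding orth_sum_def by (simp add: Let_def)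

text \<open>
  Both sides are the block diagonal matrix with the blocks \<open>A, B, C\<close>.
\<close>

lemma orth_sum_assoc: "orth_sum (orth_sum A B) C = orth_sum A (orth_sum B C)"
  using diag_block_mat_append_orth_sum[of "[A, B]" "[C]"]
    diag_block_mat_append_orth_sum[of "[A]" "[B, C]"]
    diag_block_mat_append_orth_sum[of "[A]" "[B]"]
    diag_block_mat_append_orth_sum[of "[B]" "[C]"]
  by (simp del: diag_block_mat.simps)

lemma smult_orth_sum: "c \<cdot>\<^sub>m orth_sum A B = orth_sum (c \<cdot>\<^sub>m A) (c \<cdot>\<^sub>m B)"
  unfolding orth_sum_def by (intro eq_matI) auto

lemma smult_smult_mat: "c \<cdot>\<^sub>m (d \<cdot>\<^sub>m A) = (c * d) \<cdot>\<^sub>m (A :: 'a::field mat)"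
  by (intro eq_matI) auto

lemma one_smult_mat [simp]: "1 \<cdot>\<^sub>m A = (A :: 'a::field mat)"
  by (intro eq_matI) auto

lemma qf_value_orth_sum:
  assumes "A \<in> carrier_mat n n" "B \<in> carrier_mat m m" "x \<in> carrier_vec n" "y \<in> carrier_vec m"
  shows "qf_value (orth_sum A B) (x @\<^sub>v y) = qf_value A x + qf_value B y"
proof -
  have "orth_sum A B *\<^sub>v (x @\<^sub>v y) = (A *\<^sub>v x) @\<^sub>v (B *\<^sub>v y)"
    unfolding orth_sum_def using assms mult_mat_vec_split[OF assms] by simp
  moreover have "A *\<^sub>v x \<in> carrier_vec n" "B *\<^sub>v y \<in> carrier_vec m" using assms by auto
  ultimately show ?thesis using assms unfolding qf_value_def
    by (simp add: scalar_prod_append[of _ n _ m])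
qed

lemma zero_append_vec: "0\<^sub>v n @\<^sub>v 0\<^sub>v m = (0\<^sub>v (n + m) :: 'a::zero vec)"
  by (intro eq_vecI) auto

lemma append_vec_zero_iff:
  assumes "x \<in> carrier_vec n"
  shows "x @\<^sub>v y = (0\<^sub>v (n + m) :: 'a::zero vec) \<longleftrightarrow> x = 0\<^sub>v n \<and> y = 0\<^sub>v m"
  using assms append_vec_eq[of x n "0\<^sub>v n" y "0\<^sub>v m"] by (simp add: zero_append_vec[symmetric])

text \<open>
  Most isometries below substitute linear combinations of two blocks of variables for each other.
  The row blocks of the substitution may differ in size from its column blocks, which is what
  exchanging two summands of different dimensions requires.
\<close>

lemma isometric_blockI:
  fixes X Y :: "'a::field mat"
  assumes X: "X \<in> carrier_mat (n + m) (n + m)" and Y: "Y \<in> carrier_mat (n + m) (n + m)"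
    and r: "r1 + r2 = n + m"
    and P: "PA \<in> carrier_mat r1 n" "PB \<in> carrier_mat r1 m"
      "PC \<in> carrier_mat r2 n" "PD \<in> carrier_mat r2 m"
    and val: "\<And>x y. x \<in> carrier_vec n \<Longrightarrow> y \<in> carrier_vec m \<Longrightarrow>
      qf_value X ((PA *\<^sub>v x + PB *\<^sub>v y) @\<^sub>v (PC *\<^sub>v x + PD *\<^sub>v y)) = qf_value Y (x @\<^sub>v y)"
    and ker: "\<And>x y. x \<in> carrier_vec n \<Longrightarrow> y \<in> carrier_vec m \<Longrightarrow> PA *\<^sub>v x + PB *\<^sub>v y = 0\<^sub>v r1 \<Longrightarrow>
      PC *\<^sub>v x + PD *\<^sub>v y = 0\<^sub>v r2 \<Longrightarrow> x = 0\<^sub>v n \<and> y = 0\<^sub>v m"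
  shows "isometric X Y"
proof (rule isometricI[where n = "n + m" and P = "four_block_mat PA PB PC PD"])
  show "four_block_mat PA PB PC PD \<in> carrier_mat (n + m) (n + m)"
    using four_block_carrier_mat[OF P(1) P(4)] r by simp
  have M: "four_block_mat PA PB PC PD *\<^sub>v (x @\<^sub>v y) =
      (PA *\<^sub>v x + PB *\<^sub>v y) @\<^sub>v (PC *\<^sub>v x + PD *\<^sub>v y)"
    if "x \<in> carrier_vec n" "y \<in> carrier_vec m" for x y
    by (rule four_block_mat_mult_vec[OF P that])
  fix z :: "'a vec" assume zc: "z \<in> carrier_vec (n + m)"
  define x where "x = vec_first z n"
  define y where "y = vec_last z m"
  have x: "x \<in> carrier_vec n" and y: "y \<in> carrier_vec m" and z: "z = x @\<^sub>v y"
    using zc unfolding x_def y_def by auto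
  show "qf_value X (four_block_mat PA PB PC PD *\<^sub>v z) = qf_value Y z"
    unfolding z M[OF x y] by (rule val[OF x y])
  assume "four_block_mat PA PB PC PD *\<^sub>v z = 0\<^sub>v (n + m)"
  moreover have "PA *\<^sub>v x + PB *\<^sub>v y \<in> carrier_vec r1" using P x y by auto
  ultimately have "PA *\<^sub>v x + PB *\<^sub>v y = 0\<^sub>v r1 \<and> PC *\<^sub>v x + PD *\<^sub>v y = 0\<^sub>v r2"
    unfolding z M[OF x y] r[symmetric] by (simp add: append_vec_zero_iff)
  then show "z = 0\<^sub>v (n + m)" using ker[OF x y] z by (simp add: zero_append_vec)
qed (use X Y in auto)

lemma isometric_orth_sum:
  assumes "isometric A B" "isometric C D"
  shows "isometric (orth_sum A C) (orth_sum B D)"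
proof -
  from assms(1) obtain n P where A: "A \<in> carrier_mat n n" "B \<in> carrier_mat n n"
    and P: "P \<in> carrier_mat n n"
    and kP: "\<And>x. x \<in> carrier_vec n \<Longrightarrow> P *\<^sub>v x = 0\<^sub>v n \<Longrightarrow> x = 0\<^sub>v n"
    and vP: "\<And>x. x \<in> carrier_vec n \<Longrightarrow> qf_value A (P *\<^sub>v x) = qf_value B x"
    by (rule isometricE) blast
  from assms(2) obtain m R where C: "C \<in> carrier_mat m m" "D \<in> carrier_mat m m"
    and R: "R \<in> carrier_mat m m"
    and kR: "\<And>x. x \<in> carrier_vec m \<Longrightarrow> R *\<^sub>v x = 0\<^sub>v m \<Longrightarrow> x = 0\<^sub>v m"
    and vR: "\<And>x. x \<in> carrier_vec m \<Longrightarrow> qf_value C (R *\<^sub>v x) = qf_value D x"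
    by (rule isometricE) blast
  have z: "0\<^sub>m n m *\<^sub>v y = 0\<^sub>v n" "0\<^sub>m m n *\<^sub>v x = 0\<^sub>v m"
      "P *\<^sub>v x \<in> carrier_vec n" "R *\<^sub>v y \<in> carrier_vec m"
    if "x \<in> carrier_vec n" "y \<in> carrier_vec m" for x y :: "'a vec"
    using that P R by auto
  show ?thesis
    by (rule isometric_blockI[where PA = P and PB = "0\<^sub>m n m" and PC = "0\<^sub>m m n" and PD = R])
      (use A C P R in \<open>auto simp: z qf_value_orth_sum vP vR intro: kP kR\<close>)
qed

lemma isometric_orth_sum_commute:
  assumes A: "A \<in> carrier_mat n n" and B: "B \<in> carrier_mat m m"
  shows "isometric (orth_sum A B) (orth_sum B A)"
proof -
  have z: "0\<^sub>m n m *\<^sub>v y = 0\<^sub>v n" "0\<^sub>m m n *\<^sub>v x = 0\<^sub>v m" 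
    if "x \<in> carrier_vec n" "y \<in> carrier_vec m" for x y :: "'a vec"
    using that by auto
  have c: "orth_sum A B \<in> carrier_mat (n + m) (n + m)" "orth_sum B A \<in> carrier_mat (n + m) (n + m)"
    using orth_sum_carrier[OF A B] orth_sum_carrier[OF B A] by (simp_all add: add.commute)
  show ?thesis
    by (rule isometric_blockI[where PA = "0\<^sub>m n m" and PB = "1\<^sub>m n" and PC = "1\<^sub>m m" and PD = "0\<^sub>m m n"
          and n = m and m = n])
      (use A B c in \<open>auto simp: z qf_value_orth_sum add.commute\<close>)
qed

lemma isometric_smult:
  assumes "isometric A B"
  shows "isometric (c \<cdot>\<^sub>m A) (c \<cdot>\<^sub>m B)"
proof -
  from assms obtain n P where A: "A \<in> carrier_mat n n" "B \<in> carrier_mat n n"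
    and P: "P \<in> carrier_mat n n"
    and kP: "\<And>x. x \<in> carrier_vec n \<Longrightarrow> P *\<^sub>v x = 0\<^sub>v n \<Longrightarrow> x = 0\<^sub>v n"
    and vP: "\<And>x. x \<in> carrier_vec n \<Longrightarrow> qf_value A (P *\<^sub>v x) = qf_value B x"
    by (rule isometricE) blast
  have z: "P *\<^sub>v x \<in> carrier_vec n" if "x \<in> carrier_vec n" for x using that P by auto
  show ?thesis
    by (rule isometricI[where n = n and P = P])
      (use A P in \<open>auto simp: z vP qf_value_smult[of _ n] intro: kP\<close>)
qed

lemma isometric_square_smult:
  assumes A: "A \<in> carrier_mat n n" and c: "c \<noteq> 0"
  shows "isometric A (c\<^sup>2 \<cdot>\<^sub>m A)"
proof -
  have P: "(c \<cdot>\<^sub>m 1\<^sub>m n) *\<^sub>v x = c \<cdot>\<^sub>v x" if "x \<in> carrier_vec n" for x :: "'a vec"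
    using that by (intro eq_vecI) auto
  show ?thesis
  proof (rule isometricI[where n = n and P = "c \<cdot>\<^sub>m 1\<^sub>m n"])
    fix x :: "'a vec" assume x: "x \<in> carrier_vec n"
    show "qf_value A (c \<cdot>\<^sub>m 1\<^sub>m n *\<^sub>v x) = qf_value (c\<^sup>2 \<cdot>\<^sub>m A) x"
      using P[OF x] A x by (simp add: qf_value_smult qf_value_smult_vec)
    assume "c \<cdot>\<^sub>m 1\<^sub>m n *\<^sub>v x = 0\<^sub>v n"
    then have "c \<cdot>\<^sub>v x = 0\<^sub>v n" using P[OF x] by simp
    then have "c * x $ i = 0" if "i < n" for i
      using that x by (metis carrier_vecD index_smult_vec(1) index_zero_vec(1))
    then show "x = 0\<^sub>v n" using c x by (intro eq_vecI) auto
  qed (use A in auto)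
qed

text \<open>
  The classical relation \<open>\<langle>a, b\<rangle> = \<langle>a + b, ab(a + b)\<rangle>\<close>, tensored with \<open>A\<close>: in
  \<open>a A(x - b y) + b A(x + a y)\<close> the two cross terms cancel.
\<close>

lemma isometric_add_slots:
  fixes A :: "'a::field mat"
  assumes A: "A \<in> carrier_mat n n" and ab: "a + b \<noteq> 0"
  shows "isometric (orth_sum (a \<cdot>\<^sub>m A) (b \<cdot>\<^sub>m A))
           (orth_sum ((a + b) \<cdot>\<^sub>m A) ((a * b * (a + b)) \<cdot>\<^sub>m A))"
proof -
  have P: "(c \<cdot>\<^sub>m 1\<^sub>m n) *\<^sub>v x = c \<cdot>\<^sub>v x" if "x \<in> carrier_vec n" for x :: "'a vec" and c
    using that by (intro eq_vecI) auto
  show ?thesis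
  proof (rule isometric_blockI[where n = n and m = n and PA = "1\<^sub>m n"
        and PB = "(- b) \<cdot>\<^sub>m 1\<^sub>m n" and PC = "1\<^sub>m n" and PD = "a \<cdot>\<^sub>m 1\<^sub>m n"])
    fix x y :: "'a vec" assume x: "x \<in> carrier_vec n" and y: "y \<in> carrier_vec n"
    have Ay: "A *\<^sub>v y \<in> carrier_vec n" and Ax: "A *\<^sub>v x \<in> carrier_vec n" using A x y by auto
    \<comment> \<open>The matrix need not be symmetric, so the polar form is the symmetrised expression in the middle.\<close>
    have q: "qf_value A (x + c \<cdot>\<^sub>v y) =
        qf_value A x + c * (x \<bullet> (A *\<^sub>v y) + y \<bullet> (A *\<^sub>v x)) + c\<^sup>2 * qf_value A y" for c
      using A x y Ax Ay
      by (simp add: qf_value_add qf_value_smult_vec mult_mat_vec algebra_simps)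
    \<comment> \<open>\<open>t\<close> stands for the polar form at \<open>(x, y)\<close>, which enters both summands linearly.\<close>
    have "a * (qf_value A x + (- b) * t + (- b)\<^sup>2 * qf_value A y) +
        b * (qf_value A x + a * t + a\<^sup>2 * qf_value A y)
      = (a + b) * qf_value A x + a * b * (a + b) * qf_value A y" for t
      by (simp add: algebra_simps power2_eq_square)
    moreover have "x + t \<cdot>\<^sub>v y \<in> carrier_vec n" for t using x y by auto
    moreover have "t \<cdot>\<^sub>m A \<in> carrier_mat n n" for t using A by auto
    ultimately show "qf_value (orth_sum (a \<cdot>\<^sub>m A) (b \<cdot>\<^sub>m A))
         ((1\<^sub>m n *\<^sub>v x + ((- b) \<cdot>\<^sub>m 1\<^sub>m n) *\<^sub>v y) @\<^sub>v (1\<^sub>m n *\<^sub>v x + (a \<cdot>\<^sub>m 1\<^sub>m n) *\<^sub>v y)) =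
        qf_value (orth_sum ((a + b) \<cdot>\<^sub>m A) ((a * b * (a + b)) \<cdot>\<^sub>m A)) (x @\<^sub>v y)"
      using A x y by (simp add: P q qf_value_orth_sum[of _ n _ n] qf_value_smult[of _ n]
          del: smult_carrier_mat smult_carrier_vec add_carrier_vec)
    assume "1\<^sub>m n *\<^sub>v x + ((- b) \<cdot>\<^sub>m 1\<^sub>m n) *\<^sub>v y = 0\<^sub>v n" "1\<^sub>m n *\<^sub>v x + (a \<cdot>\<^sub>m 1\<^sub>m n) *\<^sub>v y = 0\<^sub>v n"
    then have e: "x + (- b) \<cdot>\<^sub>v y = 0\<^sub>v n" "x + a \<cdot>\<^sub>v y = 0\<^sub>v n" using P x y by auto
    have "x $ i - b * y $ i = 0 \<and> x $ i + a * y $ i = 0" if i: "i < n" for i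
      using arg_cong[OF e(1), of "\<lambda>v. vec_index v i"]
        arg_cong[OF e(2), of "\<lambda>v. vec_index v i"] i x y by auto
    then have "x $ i = 0 \<and> y $ i = 0" if i: "i < n" for i
    proof -
      assume h: "\<And>i. i < n \<Longrightarrow> x $ i - b * y $ i = 0 \<and> x $ i + a * y $ i = 0"
      have "(a + b) * y $ i = (x $ i + a * y $ i) - (x $ i - b * y $ i)" by (simp add: algebra_simps)
      then have "y $ i = 0" using h[OF i] ab by auto
      then show ?thesis using h[OF i] by simp
    qed
    then show "x = 0\<^sub>v n \<and> y = 0\<^sub>v n" using x y by (auto intro!: eq_vecI)
  qed (use A in auto)
qed

section \<open>Binary forms\<close>

definition plane_vec :: "'a \<Rightarrow> 'a \<Rightarrow> 'a vec" where
  "plane_vec x y = vec 2 (\<lambda>i. if i = 0 then x else y)"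

definition plane_mat :: "'a \<Rightarrow> 'a \<Rightarrow> 'a \<Rightarrow> 'a \<Rightarrow> 'a mat" where
  "plane_mat p q r s = mat_of_rows_list 2 [[p, q], [r, s]]"

lemma plane_vec_carrier [simp]: "plane_vec x y \<in> carrier_vec 2"
  unfolding plane_vec_def by simp

lemma plane_mat_carrier [simp]: "plane_mat p q r s \<in> carrier_mat 2 2"
  unfolding plane_mat_def mat_of_rows_list_def carrier_mat_def by simp

lemma plane_vec_cases:
  assumes "v \<in> carrier_vec 2"
  obtains x y where "v = plane_vec x y"
proof
  show "v = plane_vec (vec_index v 0) (vec_index v 1)"
    using assms by (intro eq_vecI) (auto simp: plane_vec_def less_2_cases_iff)
qed

lemma plane_vec_eq_iff [simp]: "plane_vec x y = plane_vec x' y' \<longleftrightarrow> x = x' \<and> y = y'"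
proof
  assume e: "plane_vec x y = plane_vec x' y'"
  have "vec_index (plane_vec x y) 0 = vec_index (plane_vec x' y') 0"
    "vec_index (plane_vec x y) 1 = vec_index (plane_vec x' y') 1" using e by simp_all
  then show "x = x' \<and> y = y'" unfolding plane_vec_def by simp
qed simp

lemma zero_plane_vec: "0\<^sub>v 2 = plane_vec 0 0"
  unfolding plane_vec_def by (intro eq_vecI) auto

lemma add_plane_vec [simp]: "plane_vec x y + plane_vec x' y' = plane_vec (x + x') (y + y')"
  unfolding plane_vec_def by (intro eq_vecI) auto

lemma plane_mat_mult_vec [simp]:
  fixes p q r s :: "'a::field"
  shows "plane_mat p q r s *\<^sub>v plane_vec x y = plane_vec (p * x + q * y) (r * x + s * y)"
proof (rule eq_vecI)
  fix i assume "i < dim_vec (plane_vec (p * x + q * y) (r * x + s * y))"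
  then have "i = 0 \<or> i = 1" by (auto simp: plane_vec_def)
  then show "vec_index (plane_mat p q r s *\<^sub>v plane_vec x y) i =
      vec_index (plane_vec (p * x + q * y) (r * x + s * y)) i"
    by (auto simp: plane_mat_def plane_vec_def mat_of_rows_list_def scalar_prod_def row_def numeral_2_eq_2)
qed (simp add: plane_mat_def plane_vec_def mat_of_rows_list_def)

lemma qf_value_plane:
  "qf_value (plane_mat p q r s) (plane_vec x y) = p * x\<^sup>2 + (q + r) * x * y + s * y\<^sup>2"
proof -
  have "plane_vec x y \<bullet> plane_vec x' y' = x * x' + y * y'" for x' y'
    by (simp add: plane_vec_def scalar_prod_def numeral_2_eq_2)
  then show ?thesis
    unfolding qf_value_def by (simp add: algebra_simps power2_eq_square)
qed

lemma isometric_planeI: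
  fixes p q r s :: "'a::field"
  assumes X: "X \<in> carrier_mat 2 2" and Y: "Y \<in> carrier_mat 2 2"
    and det: "p * s \<noteq> q * r"
    and val: "\<And>x y. qf_value X (plane_vec (p * x + q * y) (r * x + s * y)) = qf_value Y (plane_vec x y)"
  shows "isometric X Y"
proof (rule isometricI[where P = "plane_mat p q r s", OF X Y])
  fix v :: "'a vec" assume "v \<in> carrier_vec 2"
  then obtain x y where v: "v = plane_vec x y" by (rule plane_vec_cases)
  show "qf_value X (plane_mat p q r s *\<^sub>v v) = qf_value Y v" using val v by simp
  assume "plane_mat p q r s *\<^sub>v v = 0\<^sub>v 2"
  then have e: "p * x + q * y = 0" "r * x + s * y = 0" using v by (simp_all add: zero_plane_vec)
  have "(p * s - q * r) * x = s * (p * x + q * y) - q * (r * x + s * y)"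
    "(p * s - q * r) * y = p * (r * x + s * y) - r * (p * x + q * y)" by (simp_all add: algebra_simps)
  then have "(p * s - q * r) * x = 0" "(p * s - q * r) * y = 0" unfolding e by simp_all
  then show "v = 0\<^sub>v 2" using det v by (simp add: zero_plane_vec)
qed simp

section \<open>Hyperbolic forms\<close>

lemma hyperbolic_plane_mat: "hyperbolic_plane = plane_mat 0 1 0 0"
  unfolding hyperbolic_plane_def plane_mat_def ..

lemma hyperbolic_isometric: "isometric A B \<Longrightarrow> hyperbolic B \<Longrightarrow> hyperbolic A"
  unfolding hyperbolic_def using isometric_trans by blast

lemma hyperbolic_orth_sum:
  assumes "hyperbolic A" "hyperbolic B"
  shows "hyperbolic (orth_sum A B)"
proof -
  from assms obtain m n
    where A: "isometric A (diag_block_mat (replicate m hyperbolic_plane))"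
      and B: "isometric B (diag_block_mat (replicate n hyperbolic_plane))"
    unfolding hyperbolic_def by blast
  have "isometric (orth_sum A B) (diag_block_mat (replicate (m + n) hyperbolic_plane))"
    unfolding replicate_add diag_block_mat_append_orth_sum by (rule isometric_orth_sum[OF A B])
  then show ?thesis unfolding hyperbolic_def by blast
qed

lemma hyperbolic_hyperbolic_plane: "hyperbolic (hyperbolic_plane :: 'a::field mat)"
proof -
  have "isometric (hyperbolic_plane :: 'a mat) (diag_block_mat (replicate 1 hyperbolic_plane))"
    using isometric_refl[of hyperbolic_plane 2] by (simp add: hyperbolic_plane_mat del: diag_block_mat.simps)
  then show ?thesis unfolding hyperbolic_def by blast
qed

lemma hyperbolic_smult:
  fixes A :: "'a::field mat"
  assumes c: "c \<noteq> 0" and "hyperbolic A"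
  shows "hyperbolic (c \<cdot>\<^sub>m A)"
proof -
  have plane: "hyperbolic (c \<cdot>\<^sub>m (hyperbolic_plane :: 'a mat))"
  proof (rule hyperbolic_isometric[OF _ hyperbolic_hyperbolic_plane])
    show "isometric (c \<cdot>\<^sub>m hyperbolic_plane) (hyperbolic_plane :: 'a mat)"
      by (rule isometric_planeI[where p = "inverse c" and q = 0 and r = 0 and s = 1])
        (use c in \<open>auto simp: hyperbolic_plane_mat qf_value_smult[of _ 2] qf_value_plane\<close>)
  qed
  have *: "hyperbolic (c \<cdot>\<^sub>m diag_block_mat (replicate m (hyperbolic_plane :: 'a mat)))" for m
  proof (induction m)
    case 0
    have "isometric (c \<cdot>\<^sub>m 0\<^sub>m 0 0) (0\<^sub>m 0 0 :: 'a mat)"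
      by (rule isometricI[where n = 0 and P = "0\<^sub>m 0 0"]) (auto simp: qf_value_def scalar_prod_def)
    then have "isometric (c \<cdot>\<^sub>m diag_block_mat (replicate 0 (hyperbolic_plane :: 'a mat)))
      (diag_block_mat (replicate 0 hyperbolic_plane))" by simp
    then show ?case unfolding hyperbolic_def by blast
  next
    case (Suc m)
    then show ?case
      unfolding replicate_Suc diag_block_mat_Cons_orth_sum smult_orth_sum
      by (intro hyperbolic_orth_sum plane)
  qed
  from assms(2) obtain m where "isometric A (diag_block_mat (replicate m hyperbolic_plane))"
    unfolding hyperbolic_def by blast
  from isometric_smult[OF this] * show ?thesis by (rule hyperbolic_isometric)
qed

section \<open>Norm forms of quadratic algebras\<close>

text \<open>
  This is \<open>x\<^sup>2 + s x y + a y\<^sup>2\<close>, the norm form of the algebra \<open>F[t] / (t\<^sup>2 - s t + a)\<close>. It covers both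
  characteristics at once: \<open>s = 1\<close> gives \<open>[1, a]\<close> and \<open>s = 0\<close> gives \<open>\<langle>1, a\<rangle>\<close>. The polar form is
  nondegenerate exactly if \<open>s\<^sup>2 \<noteq> 4 a\<close>.
\<close>

abbreviation norm_plane :: "'a::field \<Rightarrow> 'a \<Rightarrow> 'a mat" where
  "norm_plane s a \<equiv> plane_mat 1 s 0 a"

text \<open>
  The norm is multiplicative, so multiplication by an element of nonzero norm \<open>c\<close> is a similarity
  with factor \<open>c\<close>. The substitution below is multiplication by \<open>x + y t\<close> in the basis \<open>1, t\<close>.
\<close>

lemma norm_plane_round:
  assumes "v \<in> carrier_vec 2" "qf_value (norm_plane s a) v \<noteq> 0"
  shows "isometric (norm_plane s a) (qf_value (norm_plane s a) v \<cdot>\<^sub>m norm_plane s a)"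
proof -
  from assms(1) obtain x y where v: "v = plane_vec x y" by (rule plane_vec_cases)
  show ?thesis
  proof (rule isometric_planeI[where p = x and q = "- a * y" and r = y and s = "x + s * y"])
    show "x * (x + s * y) \<noteq> - a * y * y"
      using assms(2) v by (simp add: qf_value_plane algebra_simps power2_eq_square eq_neg_iff_add_eq_0)
  qed (auto simp: v qf_value_smult[of _ 2] qf_value_plane algebra_simps power2_eq_square)
qed

text \<open>
  A nontrivial zero gives a root of \<open>T\<^sup>2 + s T + a\<close>, so the form splits into two linear factors;
  they are linearly independent since the discriminant \<open>s\<^sup>2 - 4 a\<close> does not vanish.
\<close>

lemma norm_plane_isotropic_imp_hyperbolic:
  assumes disc: "s\<^sup>2 \<noteq> 4 * a"
    and v: "v \<in> carrier_vec 2" "v \<noteq> 0\<^sub>v 2" "qf_value (norm_plane s a) v = 0"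
  shows "hyperbolic (norm_plane s a)"
proof -
  from v(1) obtain x y where xy: "v = plane_vec x y" by (rule plane_vec_cases)
  have eq: "x\<^sup>2 + s * x * y + a * y\<^sup>2 = 0" using v(3) by (simp add: xy qf_value_plane)
  \<comment> \<open>If \<open>y = 0\<close>, then \<open>x\<^sup>2 = 0\<close> and the vector is zero.\<close>
  have y: "y \<noteq> 0" using eq v(2) xy by (auto simp: zero_plane_vec)
  define r where "r = x / y"
  have "(r\<^sup>2 + s * r + a) * y\<^sup>2 = x\<^sup>2 + s * x * y + a * y\<^sup>2"
    using y unfolding r_def by (simp add: field_simps power2_eq_square)
  then have root: "r\<^sup>2 + s * r + a = 0" using eq y by simp
  have "a = (r\<^sup>2 + s * r + a) - r\<^sup>2 - s * r" by simp
  then have a: "a = - r\<^sup>2 - s * r" unfolding root by simp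
  \<comment> \<open>The factors are \<open>X - r Y\<close> and \<open>X + (s + r) Y\<close>; they become the hyperbolic coordinates.\<close>
  have "isometric hyperbolic_plane (norm_plane s a)"
  proof (rule isometric_planeI[where p = 1 and q = "- r" and r = 1 and s = "s + r"])
    have "(s + r + r)\<^sup>2 = s\<^sup>2 - 4 * a" unfolding a by (simp add: algebra_simps power2_eq_square)
    then have "s + r + r \<noteq> 0" using disc by (metis eq_iff_diff_eq_0 zero_power2)
    then show "1 * (s + r) \<noteq> - r * 1" by (simp add: eq_neg_iff_add_eq_0)
  qed (auto simp: hyperbolic_plane_mat qf_value_plane a algebra_simps power2_eq_square)
  from isometric_sym[OF this] show ?thesis
    by (rule hyperbolic_isometric) (rule hyperbolic_hyperbolic_plane)
qed

text \<open>
  Put \<open>u = x - y\<close>. Then \<open>N(x) - N(y) = N(u) + b(u, y) = u\<^sub>1 w\<^sub>1 + u\<^sub>2 w\<^sub>2\<close>, where \<open>b\<close> is the polar form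
  and \<open>w\<close> depends linearly on \<open>(x, y)\<close>. Since \<open>b\<close> is nondegenerate, \<open>(u, w)\<close> are coordinates on the
  four-dimensional space.
\<close>

lemma norm_plane_minus_hyperbolic:
  fixes s a :: "'a::field"
  assumes disc: "s\<^sup>2 \<noteq> 4 * a"
  shows "hyperbolic (orth_sum (norm_plane s a) ((- 1) \<cdot>\<^sub>m norm_plane s a))"
proof -
  let ?H = "hyperbolic_plane :: 'a mat" and ?N = "norm_plane s a"
  have "isometric (orth_sum ?H ?H) (orth_sum ?N ((- 1) \<cdot>\<^sub>m ?N))"
  proof (rule isometric_blockI[where ?r1.0 = 2 and ?r2.0 = 2 and n = 2 and m = 2
        and PA = "plane_mat 1 0 1 s" and PB = "plane_mat (- 1) 0 1 0"
        and PC = "plane_mat 0 1 0 a" and PD = "plane_mat 0 (- 1) s a"])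
    show "orth_sum ?H ?H \<in> carrier_mat (2 + 2) (2 + 2)"
      "orth_sum ?N ((- 1) \<cdot>\<^sub>m ?N) \<in> carrier_mat (2 + 2) (2 + 2)"
      using orth_sum_carrier[of ?H 2 ?H 2] orth_sum_carrier[of ?N 2 "(- 1) \<cdot>\<^sub>m ?N" 2]
      by (simp_all only: hyperbolic_plane_mat plane_mat_carrier smult_carrier_mat)
    fix v w :: "'a vec" assume "v \<in> carrier_vec 2" "w \<in> carrier_vec 2"
    then obtain x1 x2 y1 y2 where vw: "v = plane_vec x1 x2" "w = plane_vec y1 y2"
      by (metis plane_vec_cases)
    show "qf_value (orth_sum ?H ?H) ((plane_mat 1 0 1 s *\<^sub>v v + plane_mat (- 1) 0 1 0 *\<^sub>v w) @\<^sub>v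
        (plane_mat 0 1 0 a *\<^sub>v v + plane_mat 0 (- 1) s a *\<^sub>v w)) =
      qf_value (orth_sum ?N ((- 1) \<cdot>\<^sub>m ?N)) (v @\<^sub>v w)"
      by (simp add: vw qf_value_orth_sum[of _ 2 _ 2] hyperbolic_plane_mat qf_value_smult[of _ 2]
          qf_value_plane algebra_simps power2_eq_square)
    assume h: "plane_mat 1 0 1 s *\<^sub>v v + plane_mat (- 1) 0 1 0 *\<^sub>v w = 0\<^sub>v 2"
      "plane_mat 0 1 0 a *\<^sub>v v + plane_mat 0 (- 1) s a *\<^sub>v w = 0\<^sub>v 2"
    have y: "y1 = x1" "y2 = x2" using h by (simp_all add: vw zero_plane_vec)
    have e: "2 * x1 + s * x2 = 0" "s * x1 + 2 * a * x2 = 0"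
      using h unfolding y vw by (simp_all add: zero_plane_vec algebra_simps)
    \<comment> \<open>Cramer's rule for the polar form, whose determinant is \<open>4 a - s\<^sup>2\<close>.\<close>
    have "(s\<^sup>2 - 4 * a) * x1 = s * (s * x1 + 2 * a * x2) - 2 * a * (2 * x1 + s * x2)"
      "(s\<^sup>2 - 4 * a) * x2 = s * (2 * x1 + s * x2) - 2 * (s * x1 + 2 * a * x2)"
      by (simp_all add: algebra_simps power2_eq_square)
    then have "(s\<^sup>2 - 4 * a) * x1 = 0" "(s\<^sup>2 - 4 * a) * x2 = 0" unfolding e by simp_all
    then show "v = 0\<^sub>v 2 \<and> w = 0\<^sub>v 2"
      using disc y by (simp add: vw zero_plane_vec)
  qed auto
  from isometric_sym[OF this] show ?thesis
    by (rule hyperbolic_isometric) (intro hyperbolic_orth_sum hyperbolic_hyperbolic_plane)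
qed

section \<open>Isotropy\<close>

definition isotropic :: "'a::field mat \<Rightarrow> bool" where
  "isotropic A \<longleftrightarrow> (\<exists>x\<in>carrier_vec (dim_row A). x \<noteq> 0\<^sub>v (dim_row A) \<and> qf_value A x = 0)"

lemma isotropic_isometric:
  assumes "isotropic A" "isometric A B"
  shows "isotropic B"
proof -
  from isometric_sym[OF assms(2)] obtain n P where A: "B \<in> carrier_mat n n" "A \<in> carrier_mat n n"
    and P: "P \<in> carrier_mat n n"
    and kP: "\<And>x. x \<in> carrier_vec n \<Longrightarrow> P *\<^sub>v x = 0\<^sub>v n \<Longrightarrow> x = 0\<^sub>v n"
    and vP: "\<And>x. x \<in> carrier_vec n \<Longrightarrow> qf_value B (P *\<^sub>v x) = qf_value A x"
    by (rule isometricE) blast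
  from assms(1) obtain x where x: "x \<in> carrier_vec n" "x \<noteq> 0\<^sub>v n" "qf_value A x = 0"
    unfolding isotropic_def using A by auto
  have "P *\<^sub>v x \<in> carrier_vec n" "P *\<^sub>v x \<noteq> 0\<^sub>v n" "qf_value B (P *\<^sub>v x) = 0"
    using x kP vP P by auto
  then show ?thesis unfolding isotropic_def using A by auto
qed

lemma isotropic_orth_sum:
  assumes A: "A \<in> carrier_mat n n" and B: "B \<in> carrier_mat m m" and "isotropic A"
  shows "isotropic (orth_sum A B)"
proof -
  from assms(3) obtain x where x: "x \<in> carrier_vec n" "x \<noteq> 0\<^sub>v n" "qf_value A x = 0"
    unfolding isotropic_def using A by auto
  have "x @\<^sub>v 0\<^sub>v m \<in> carrier_vec (n + m)" "x @\<^sub>v 0\<^sub>v m \<noteq> 0\<^sub>v (n + m)"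
    "qf_value (orth_sum A B) (x @\<^sub>v 0\<^sub>v m) = 0"
    using x A B by (auto simp: append_vec_zero_iff[OF x(1)] qf_value_orth_sum)
  moreover have "dim_row (orth_sum A B) = n + m" using orth_sum_carrier[OF A B] by auto
  ultimately show ?thesis unfolding isotropic_def by auto
qed

section \<open>Tensor products with diagonal bilinear forms\<close>

lemma map_times_one [simp]: "map ((*) 1) B = (B :: 'a::field list)"
  by (induction B) auto

lemma bilin_tensor_Cons: "bilin_tensor (b # B) C = map ((*) b) C @ bilin_tensor B C"
  unfolding bilin_tensor_def by simp

lemma bilin_tensor_Nil [simp]: "bilin_tensor [] C = []"
  unfolding bilin_tensor_def by simp

lemma bilin_tensor_append: "bilin_tensor (B @ C) D = bilin_tensor B D @ bilin_tensor C D"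
  by (induction B) (simp_all add: bilin_tensor_Cons)

lemma bilin_tensor_map: "bilin_tensor (map ((*) b) B) C = map ((*) b) (bilin_tensor B C)"
  by (induction B) (simp_all add: bilin_tensor_Cons mult.assoc)

lemma bilin_tensor_assoc: "bilin_tensor (bilin_tensor B C) D = bilin_tensor B (bilin_tensor C D)"
  by (induction B) (simp_all add: bilin_tensor_Cons bilin_tensor_append bilin_tensor_map)

lemma bilin_tensor_one [simp]: "bilin_tensor [1] C = C"
  by (simp add: bilin_tensor_Cons)

lemma pfister_diag_append:
  "pfister_diag (as @ bs) = bilin_tensor (pfister_diag as) (pfister_diag bs)"
  by (induction as) (simp_all add: bilin_tensor_assoc)

lemma pfister_diag_singleton: "pfister_diag [a] = [1, - a]"
  by (simp add: bilin_tensor_Cons)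

lemma pfister_diag_Cons_append: 
  "pfister_diag (a # as) = pfister_diag as @ map ((*) (- a)) (pfister_diag as)"
  by (simp add: bilin_tensor_Cons)

lemma pfister_diag_hd: "\<exists>B. pfister_diag as = 1 # B"
  by (induction as) (auto simp: bilin_tensor_Cons)

lemma length_pfister_diag: "length (pfister_diag as) = 2 ^ length as"
  by (induction as) (simp_all add: bilin_tensor_Cons)

text \<open>
  With \<open>\<phi>\<^sub>i = 1 \<perp> \<phi>\<^sub>i'\<close>, the product \<open>\<phi>\<^sub>1 \<otimes> \<phi>\<^sub>2\<close> contains the subform \<open>1 \<perp> \<phi>\<^sub>1' \<perp> \<phi>\<^sub>2' = \<phi>\<^sub>1 \<perp> \<phi>\<^sub>2'\<close>.
\<close>

lemma mset_bilin_tensor_one: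
  "mset (bilin_tensor (1 # B) (1 # C)) = mset ((1 # B @ C) @ bilin_tensor B C)"
proof -
  have "mset (bilin_tensor B (1 # C)) = mset B + mset (bilin_tensor B C)"
    by (induction B) (simp_all add: bilin_tensor_Cons)
  then show ?thesis by (simp add: bilin_tensor_Cons)
qed

lemma bilin_quad_tensor_Nil [simp]: "bilin_quad_tensor [] A = 0\<^sub>m 0 0"
  unfolding bilin_quad_tensor_def by simp

lemma bilin_quad_tensor_Cons:
  "bilin_quad_tensor (b # B) A = orth_sum (b \<cdot>\<^sub>m A) (bilin_quad_tensor B A)"
  unfolding bilin_quad_tensor_def by (simp only: list.map diag_block_mat_Cons_orth_sum)

lemma bilin_quad_tensor_singleton: "bilin_quad_tensor [b] A = b \<cdot>\<^sub>m A"
  unfolding bilin_quad_tensor_def by (simp only: list.map diag_block_mat_singleton)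

lemma bilin_quad_tensor_append:
  "bilin_quad_tensor (B @ C) A = orth_sum (bilin_quad_tensor B A) (bilin_quad_tensor C A)"
  unfolding bilin_quad_tensor_def by (simp only: map_append diag_block_mat_append_orth_sum)

lemma bilin_quad_tensor_carrier:
  "A \<in> carrier_mat n n \<Longrightarrow> bilin_quad_tensor B A \<in> carrier_mat (length B * n) (length B * n)"
  by (induction B) (auto simp: bilin_quad_tensor_Cons)

lemma smult_bilin_quad_tensor:
  "bilin_quad_tensor (map ((*) c) B) A = c \<cdot>\<^sub>m bilin_quad_tensor B A"
  by (induction B) (auto simp: bilin_quad_tensor_Cons smult_orth_sum smult_smult_mat)

lemma bilin_quad_tensor_assoc:
  "bilin_quad_tensor (bilin_tensor B C) A = bilin_quad_tensor B (bilin_quad_tensor C A)"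
  by (induction B)
    (simp_all add: bilin_tensor_Cons bilin_quad_tensor_Cons bilin_quad_tensor_append smult_bilin_quad_tensor)

lemma bilin_quad_tensor_cong:
  assumes "isometric A A'"
  shows "isometric (bilin_quad_tensor B A) (bilin_quad_tensor B A')"
proof (induction B)
  case Nil
  show ?case by (auto intro: isometric_refl[of _ 0])
next
  case (Cons b B)
  then show ?case unfolding bilin_quad_tensor_Cons
    by (intro isometric_orth_sum isometric_smult assms)
qed

text \<open>
  Diagonal forms are lists, so the order of the entries matters for the matrix but not for the
  isometry class.
\<close>

lemma bilin_quad_tensor_permute:
  assumes A: "A \<in> carrier_mat n n" and "mset B = mset C"
  shows "isometric (bilin_quad_tensor B A) (bilin_quad_tensor C A)"
  using assms(2)
proof (induction B arbitrary: C)
  case Nil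
  then show ?case by (auto intro: isometric_refl[of _ 0])
next
  case (Cons b B)
  note car = bilin_quad_tensor_carrier[OF A]
  from Cons.prems have "b \<in> set C" by (metis list.set_intros(1) set_mset_mset)
  then obtain C1 C2 where C: "C = C1 @ b # C2" by (meson split_list)
  with Cons.prems have "mset B = mset (C1 @ C2)" by simp
  from Cons.IH[OF this]
  have "isometric (bilin_quad_tensor (b # B) A)
      (orth_sum (bilin_quad_tensor [b] A) (bilin_quad_tensor (C1 @ C2) A))"
    unfolding bilin_quad_tensor_singleton bilin_quad_tensor_Cons[of b B]
    using A by (intro isometric_orth_sum isometric_refl[of _ n]) auto
  also have "\<dots> = orth_sum (orth_sum (bilin_quad_tensor [b] A) (bilin_quad_tensor C1 A))
      (bilin_quad_tensor C2 A)"
    by (simp only: bilin_quad_tensor_append orth_sum_assoc)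
  also have "isometric \<dots> (orth_sum (orth_sum (bilin_quad_tensor C1 A) (bilin_quad_tensor [b] A))
      (bilin_quad_tensor C2 A))"
    by (intro isometric_orth_sum isometric_orth_sum_commute[OF car car] isometric_refl[OF car])
  also have "\<dots> = bilin_quad_tensor C A"
    unfolding C by (simp add: bilin_quad_tensor_append[symmetric])
  finally show ?case .
qed

section \<open>Isotropic Pfister forms are hyperbolic\<close>

abbreviation pfister_form :: "'a::field list \<Rightarrow> 'a mat \<Rightarrow> 'a mat" where
  "pfister_form as N \<equiv> bilin_quad_tensor (pfister_diag as) N"

lemma pfister_form_Nil: "pfister_form [] N = N"
  by (simp add: bilin_quad_tensor_singleton)

lemma pfister_form_Cons:
  "pfister_form (a # as) N = orth_sum (pfister_form as N) ((- a) \<cdot>\<^sub>m pfister_form as N)"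
  by (simp only: pfister_diag_Cons_append bilin_quad_tensor_append smult_bilin_quad_tensor)

text \<open>
  The condition concerns nonzero values of possibly isotropic forms, since doubling may turn an
  anisotropic form into an isotropic one.
\<close>

definition round_form :: "'a::field mat \<Rightarrow> bool" where
  "round_form A \<longleftrightarrow> (\<forall>x\<in>carrier_vec (dim_row A). qf_value A x \<noteq> 0 \<longrightarrow>
     isometric A (qf_value A x \<cdot>\<^sub>m A))"

lemma round_formD:
  "round_form A \<Longrightarrow> A \<in> carrier_mat n n \<Longrightarrow> x \<in> carrier_vec n \<Longrightarrow> qf_value A x \<noteq> 0 \<Longrightarrow>
    isometric A (qf_value A x \<cdot>\<^sub>m A)"
  unfolding round_form_def by auto

text \<open>
  Let \<open>c = \<alpha> - a \<beta>\<close> be a value of \<open>A \<perp> -a A\<close>, with \<open>\<alpha>\<close> and \<open>\<beta>\<close> values of \<open>A\<close>. In the generic case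
  \<open>A\<close> absorbs the factors \<open>\<alpha>\<close> and \<open>\<beta>\<close>, so the form is \<open>\<langle>\<alpha>, -a \<beta>\<rangle> \<otimes> A\<close>, and
  \<open>\<langle>\<alpha>, -a \<beta>\<rangle> = c \<langle>1, -a \<alpha> \<beta>\<rangle>\<close>; absorbing \<open>\<alpha> \<beta>\<close> again leaves \<open>c (A \<perp> -a A)\<close>. If \<open>\<alpha>\<close> or \<open>\<beta>\<close>
  vanishes, the similarity is visible directly, up to exchanging the two summands.
\<close>

lemma round_form_double:
  fixes A :: "'a::field mat"
  assumes A: "A \<in> carrier_mat n n" and round: "round_form A" and a: "a \<noteq> 0"
  shows "round_form (orth_sum A ((- a) \<cdot>\<^sub>m A))" (is "round_form ?Q")
  unfolding round_form_def
proof (intro ballI impI)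
  fix z assume z: "z \<in> carrier_vec (dim_row ?Q)" and nz: "qf_value ?Q z \<noteq> 0"
  have aA: "(- a) \<cdot>\<^sub>m A \<in> carrier_mat n n" using A by simp
  have zc: "z \<in> carrier_vec (n + n)" using z carrier_matD(1)[OF orth_sum_carrier[OF A aA]] by simp
  define x where "x = vec_first z n"
  define y where "y = vec_last z n"
  have x: "x \<in> carrier_vec n" and y: "y \<in> carrier_vec n" and xy: "z = x @\<^sub>v y"
    using zc unfolding x_def y_def by auto
  define \<alpha> where "\<alpha> = qf_value A x"
  define \<beta> where "\<beta> = qf_value A y"
  define c where "c = \<alpha> + - a * \<beta>"
  have val: "qf_value ?Q z = c"
    unfolding xy c_def \<alpha>_def \<beta>_def using A x y by (simp add: qf_value_orth_sum[OF A aA] qf_value_smult)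
  have c: "c \<noteq> 0" using nz val by simp
  have cQ: "c \<cdot>\<^sub>m ?Q = orth_sum (c \<cdot>\<^sub>m A) ((- a * c) \<cdot>\<^sub>m A)"
    by (simp add: smult_orth_sum smult_smult_mat mult.commute)
  have \<alpha>: "isometric A (\<alpha> \<cdot>\<^sub>m A)" if "\<alpha> \<noteq> 0"
    using round_formD[OF round A x] that unfolding \<alpha>_def by simp
  have \<beta>: "isometric A (\<beta> \<cdot>\<^sub>m A)" if "\<beta> \<noteq> 0"
    using round_formD[OF round A y] that unfolding \<beta>_def by simp
  have smA: "t \<cdot>\<^sub>m A \<in> carrier_mat n n" for t using A by simp
  have "isometric ?Q (c \<cdot>\<^sub>m ?Q)"
  proof (cases "\<beta> = 0")
    case True
    then have "c = \<alpha>" by (simp add: c_def)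
    with c \<alpha> have iso: "isometric A (c \<cdot>\<^sub>m A)" by simp
    show ?thesis unfolding smult_orth_sum[of c] 
      using isometric_orth_sum[OF iso isometric_smult[OF iso, of "- a"]]
      by (simp add: smult_smult_mat mult.commute)
  next
    case nb: False
    show ?thesis
    proof (cases "\<alpha> = 0")
      case True
      then have c': "c = - a * \<beta>" by (simp add: c_def)
      have 1: "isometric ((- a) \<cdot>\<^sub>m A) (c \<cdot>\<^sub>m A)"
        using isometric_smult[OF \<beta>[OF nb], of "- a"] by (simp add: smult_smult_mat c')
      have "isometric A (a\<^sup>2 \<cdot>\<^sub>m (\<beta> \<cdot>\<^sub>m A))"
        using isometric_trans[OF \<beta>[OF nb] isometric_square_smult[OF smA a]] .
      then have 2: "isometric A ((- a * c) \<cdot>\<^sub>m A)"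
        by (simp add: smult_smult_mat c' power2_eq_square mult.assoc)
      have "isometric ?Q (orth_sum ((- a) \<cdot>\<^sub>m A) A)"
        by (rule isometric_orth_sum_commute[OF A aA])
      also have "isometric \<dots> (c \<cdot>\<^sub>m ?Q)" unfolding cQ by (rule isometric_orth_sum[OF 1 2])
      finally show ?thesis .
    next
      case na: False
      have "isometric ?Q (orth_sum (\<alpha> \<cdot>\<^sub>m A) ((- a) \<cdot>\<^sub>m (\<beta> \<cdot>\<^sub>m A)))"
        by (intro isometric_orth_sum isometric_smult \<alpha> \<beta> na nb)
      also have "\<dots> = orth_sum (\<alpha> \<cdot>\<^sub>m A) ((- a * \<beta>) \<cdot>\<^sub>m A)" by (simp add: smult_smult_mat)
      also have "isometric \<dots> (orth_sum (c \<cdot>\<^sub>m A) ((\<alpha> * (- a * \<beta>) * c) \<cdot>\<^sub>m A))"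
        using isometric_add_slots[OF A, of \<alpha> "- a * \<beta>"] c unfolding c_def by simp
      also have "\<dots> = orth_sum (c \<cdot>\<^sub>m A) ((- a * c) \<cdot>\<^sub>m (\<alpha> \<cdot>\<^sub>m (\<beta> \<cdot>\<^sub>m A)))"
        by (simp add: smult_smult_mat mult_ac)
      also have "isometric \<dots> (c \<cdot>\<^sub>m ?Q)" unfolding cQ
      proof (intro isometric_orth_sum isometric_refl[OF smA] isometric_smult)
        have "isometric (\<alpha> \<cdot>\<^sub>m (\<beta> \<cdot>\<^sub>m A)) (\<alpha> \<cdot>\<^sub>m A)" by (intro isometric_smult isometric_sym[OF \<beta>] nb)
        also have "isometric \<dots> A" by (intro isometric_sym[OF \<alpha>] na)
        finally show "isometric (\<alpha> \<cdot>\<^sub>m (\<beta> \<cdot>\<^sub>m A)) A" .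
      qed
      finally show ?thesis .
    qed
  qed
  then show "isometric ?Q (qf_value ?Q z \<cdot>\<^sub>m ?Q)" unfolding val .
qed

text \<open>
  A zero of \<open>A \<perp> -a A\<close> is an equation \<open>A(x) = a A(y)\<close>. If both sides vanish, then \<open>A\<close> itself is
  isotropic. Otherwise roundness gives \<open>a A \<cong> a A(y) A = A(x) A \<cong> A\<close>, so the form is \<open>A \<perp> -A\<close>.
\<close>

lemma isotropic_double_imp_hyperbolic:
  fixes A :: "'a::field mat"
  assumes A: "A \<in> carrier_mat n n" and round: "round_form A" and a: "a \<noteq> 0"
    and hyp: "isotropic A \<Longrightarrow> hyperbolic A" and minus: "hyperbolic (orth_sum A ((- 1) \<cdot>\<^sub>m A))"
    and iso: "isotropic (orth_sum A ((- a) \<cdot>\<^sub>m A))"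
  shows "hyperbolic (orth_sum A ((- a) \<cdot>\<^sub>m A))"
proof -
  have aA: "(- a) \<cdot>\<^sub>m A \<in> carrier_mat n n" using A by simp
  from iso obtain z where zc: "z \<in> carrier_vec (n + n)" and z: "z \<noteq> 0\<^sub>v (n + n)"
    "qf_value (orth_sum A ((- a) \<cdot>\<^sub>m A)) z = 0"
    using carrier_matD(1)[OF orth_sum_carrier[OF A aA]] unfolding isotropic_def by auto
  define x where "x = vec_first z n"
  define y where "y = vec_last z n"
  have x: "x \<in> carrier_vec n" and y: "y \<in> carrier_vec n" and xy: "z = x @\<^sub>v y"
    using zc unfolding x_def y_def by auto
  have nz: "x \<noteq> 0\<^sub>v n \<or> y \<noteq> 0\<^sub>v n" using z(1) unfolding xy by (simp add: append_vec_zero_iff[OF x])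
  have val: "qf_value A x = a * qf_value A y"
    using z(2) unfolding xy using A x y
    by (simp add: qf_value_orth_sum[OF A aA] qf_value_smult)
  show ?thesis
  proof (cases "qf_value A y = 0")
    case True
    then have "isotropic A" using val nz x y A unfolding isotropic_def by auto
    then have "hyperbolic A" by (rule hyp)
    then show ?thesis using a by (intro hyperbolic_orth_sum hyperbolic_smult) auto
  next
    case False
    then have nx: "qf_value A x \<noteq> 0" using val a by simp
    have "isometric (a \<cdot>\<^sub>m A) (a \<cdot>\<^sub>m (qf_value A y \<cdot>\<^sub>m A))"
      by (intro isometric_smult round_formD[OF round A y] False)
    also have "\<dots> = qf_value A x \<cdot>\<^sub>m A" by (simp add: val smult_smult_mat)
    also have "isometric \<dots> A" by (intro isometric_sym[OF round_formD[OF round A x]] nx)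
    finally have "isometric ((- 1) \<cdot>\<^sub>m (a \<cdot>\<^sub>m A)) ((- 1) \<cdot>\<^sub>m A)" by (rule isometric_smult)
    then have "isometric ((- a) \<cdot>\<^sub>m A) ((- 1) \<cdot>\<^sub>m A)" by (simp add: smult_smult_mat)
    from isometric_orth_sum[OF isometric_refl[OF A] this] minus
    show ?thesis by (rule hyperbolic_isometric)
  qed
qed

text \<open>
  For \<open>q = A \<perp> -a A\<close> the form \<open>q \<perp> -q\<close> regroups as \<open>(A \<perp> -A) \<perp> -a (A \<perp> -A)\<close>.
\<close>

lemma minus_hyperbolic_double:
  fixes A :: "'a::field mat"
  assumes A: "A \<in> carrier_mat n n" and a: "a \<noteq> 0" and minus: "hyperbolic (orth_sum A ((- 1) \<cdot>\<^sub>m A))"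
  shows "hyperbolic (orth_sum (orth_sum A ((- a) \<cdot>\<^sub>m A)) ((- 1) \<cdot>\<^sub>m orth_sum A ((- a) \<cdot>\<^sub>m A)))"
proof -
  let ?B = "(- 1) \<cdot>\<^sub>m A" and ?C = "(- a) \<cdot>\<^sub>m A" and ?D = "(- a) \<cdot>\<^sub>m ((- 1) \<cdot>\<^sub>m A)"
  have car: "?B \<in> carrier_mat n n" "?C \<in> carrier_mat n n" "?D \<in> carrier_mat n n" using A by auto
  have "orth_sum (orth_sum A ?C) ((- 1) \<cdot>\<^sub>m orth_sum A ?C) = orth_sum A (orth_sum (orth_sum ?C ?B) ?D)"
    by (simp add: smult_orth_sum smult_smult_mat orth_sum_assoc)
  also have "isometric \<dots> (orth_sum A (orth_sum (orth_sum ?B ?C) ?D))"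
    by (intro isometric_orth_sum isometric_orth_sum_commute[OF car(2,1)] isometric_refl[OF A]
        isometric_refl[OF car(3)])
  also have "\<dots> = orth_sum (orth_sum A ?B) ((- a) \<cdot>\<^sub>m orth_sum A ?B)"
    by (simp add: smult_orth_sum orth_sum_assoc)
  finally show ?thesis
    by (rule hyperbolic_isometric) (intro hyperbolic_orth_sum hyperbolic_smult minus, simp add: a)
qed

text \<open>
  The three properties are proved together because the doubling step for isotropy uses all of them.
  The last one stands in for nondegeneracy: \<open>q \<perp> -q\<close> is hyperbolic for every nondegenerate \<open>q\<close>, but
  for Pfister forms this is easily carried along the doubling.
\<close>

lemma pfister_form_properties:
  fixes s a :: "'a::field"
  assumes disc: "s\<^sup>2 \<noteq> 4 * a" and "0 \<notin> set as"
  shows "round_form (pfister_form as (norm_plane s a)) \<and>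
    (isotropic (pfister_form as (norm_plane s a)) \<longrightarrow> hyperbolic (pfister_form as (norm_plane s a))) \<and>
    hyperbolic (orth_sum (pfister_form as (norm_plane s a)) ((- 1) \<cdot>\<^sub>m pfister_form as (norm_plane s a)))"
  using assms(2)
proof (induction as)
  case Nil
  have d: "dim_row (norm_plane s a) = 2" by (metis carrier_matD(1) plane_mat_carrier)
  show ?case
    using norm_plane_round[of _ s a] norm_plane_isotropic_imp_hyperbolic[OF disc]
      norm_plane_minus_hyperbolic[OF disc]
    unfolding pfister_form_Nil round_form_def isotropic_def d by blast
next
  case (Cons b as)
  then have b: "b \<noteq> 0" and as: "0 \<notin> set as" by auto
  note car = bilin_quad_tensor_carrier[OF plane_mat_carrier, of "pfister_diag as" 1 s 0 a]
  show ?case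
    using Cons.IH[OF as] round_form_double[OF car _ b] isotropic_double_imp_hyperbolic[OF car _ b]
      minus_hyperbolic_double[OF car b]
    unfolding pfister_form_Cons by blast
qed

section \<open>Isotropy of the tensor product\<close>

text \<open>
  Padding the matrix with zero rows makes it square and singular.
\<close>

lemma exists_kernel_vec:
  fixes H :: "'a::field mat"
  assumes H: "H \<in> carrier_mat n m" and nm: "n < m"
  shows "\<exists>x\<in>carrier_vec m. x \<noteq> 0\<^sub>v m \<and> H *\<^sub>v x = 0\<^sub>v n"
proof -
  define M where "M = mat m m (\<lambda>(i, j). if i < n then H $$ (i, j) else 0)"
  have M: "M \<in> carrier_mat m m" unfolding M_def by simp
  \<comment> \<open>Row \<open>n\<close> of \<open>M\<close> is the first of the padded zero rows, so this unit vector is in the left kernel.\<close>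
  define e :: "'a vec" where "e = unit_vec m n"
  have e: "e \<in> carrier_vec m" "e \<noteq> 0\<^sub>v m" unfolding e_def using nm by auto
  have "M\<^sup>T *\<^sub>v e = 0\<^sub>v m"
    unfolding e_def by (rule eq_vecI) (use nm in \<open>auto simp: M_def scalar_prod_right_unit[of _ m]\<close>)
  then have "det M\<^sup>T = 0" using e M by (subst det_0_iff_vec_prod_zero_field[of _ m]) auto
  then have "det M = 0" using det_transpose[OF M] by simp
  then obtain x where x: "x \<in> carrier_vec m" "x \<noteq> 0\<^sub>v m" "M *\<^sub>v x = 0\<^sub>v m"
    using det_0_iff_vec_prod_zero_field[OF M] by blast
  have "H *\<^sub>v x = 0\<^sub>v n"
  proof (rule eq_vecI)
    fix i assume "i < dim_vec (0\<^sub>v n :: 'a vec)"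
    then have i: "i < n" by simp
    then have "row H i = row M i" using H nm by (intro eq_vecI) (auto simp: M_def)
    moreover have "vec_index (M *\<^sub>v x) i = 0" using x(3) i nm by simp
    ultimately show "vec_index (H *\<^sub>v x) i = vec_index (0\<^sub>v n) i" using i H M nm by simp
  qed (use H in simp)
  with x show ?thesis by blast
qed

text \<open>
  Reduces an isometry to what the dimension count uses: an injective linear map defined on the first
  summand that preserves values.
\<close>

lemma isometric_orth_sum_embedding:
  fixes X :: "'a::field mat"
  assumes "isometric X (orth_sum Q Y)" and Q: "Q \<in> carrier_mat m m" and Y: "Y \<in> carrier_mat k k"
    and X: "X \<in> carrier_mat N N"
  obtains G where "G \<in> carrier_mat N m"
    and "\<And>x. x \<in> carrier_vec m \<Longrightarrow> G *\<^sub>v x = 0\<^sub>v N \<Longrightarrow> x = 0\<^sub>v m"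
    and "\<And>x. x \<in> carrier_vec m \<Longrightarrow> qf_value X (G *\<^sub>v x) = qf_value Q x"
proof -
  from assms(1) obtain n P where c: "X \<in> carrier_mat n n" "orth_sum Q Y \<in> carrier_mat n n"
    and P: "P \<in> carrier_mat n n"
    and kP: "\<And>x. x \<in> carrier_vec n \<Longrightarrow> P *\<^sub>v x = 0\<^sub>v n \<Longrightarrow> x = 0\<^sub>v n"
    and vP: "\<And>x. x \<in> carrier_vec n \<Longrightarrow> qf_value X (P *\<^sub>v x) = qf_value (orth_sum Q Y) x"
    by (rule isometricE) blast
  have n: "n = N" "n = m + k" using c X orth_sum_carrier[OF Q Y] by auto
  define E :: "'a mat" where "E = 1\<^sub>m m @\<^sub>r 0\<^sub>m k m"
  have E: "E \<in> carrier_mat n m" unfolding E_def n(2) by (rule carrier_append_rows) auto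
  have Ex: "E *\<^sub>v x = x @\<^sub>v 0\<^sub>v k" if "x \<in> carrier_vec m" for x
    unfolding E_def using mat_mult_append[of "1\<^sub>m m" m m "0\<^sub>m k m" k x] that
    by (auto intro!: arg_cong[of _ _ "append_vec x"] eq_vecI)
  have PE: "(P * E) *\<^sub>v x = P *\<^sub>v (x @\<^sub>v 0\<^sub>v k)" if "x \<in> carrier_vec m" for x
    using that P E Ex by (simp add: assoc_mult_mat_vec)
  have xk: "x @\<^sub>v 0\<^sub>v k \<in> carrier_vec n" if "x \<in> carrier_vec m" for x :: "'a vec"
    unfolding n(2) using that by simp
  show thesis
  proof (rule that[of "P * E"])
    show "P * E \<in> carrier_mat N m" using P E n by auto
    fix x :: "'a vec" assume x: "x \<in> carrier_vec m"
    show "qf_value X (P * E *\<^sub>v x) = qf_value Q x"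
      using vP[OF xk[OF x]] PE[OF x] qf_value_orth_sum[OF Q Y x, of "0\<^sub>v k"] Y by simp
    assume "P * E *\<^sub>v x = 0\<^sub>v N"
    then have "x @\<^sub>v 0\<^sub>v k = 0\<^sub>v n" using kP[OF xk[OF x]] PE[OF x] n by simp
    then show "x = 0\<^sub>v m" unfolding n(2) by (simp add: append_vec_zero_iff[OF x])
  qed
qed

text \<open>
  The central step. Let \<open>\<phi>\<^sub>1 = 1 \<perp> B1\<close> and \<open>\<phi>\<^sub>2 = 1 \<perp> B2\<close>. The isometries embed \<open>Q\<close> into \<open>\<phi>\<^sub>1 \<otimes> P\<close> and
  into \<open>\<phi>\<^sub>2 \<otimes> P\<close>, by \<open>G\<close> and \<open>K\<close> say. Because of \<open>i\<^sup>2 = -1\<close>, the vectors \<open>(G x, i K x)\<close> are zeros of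
  the orthogonal sum. As \<open>dim P < dim Q\<close>, some \<open>x \<noteq> 0\<close> has a \<open>K x\<close> whose component in the
  first summand \<open>P\<close> of \<open>\<phi>\<^sub>2 \<otimes> P\<close> vanishes. This gives a zero of \<open>(\<phi>\<^sub>1 \<perp> B2) \<otimes> P\<close>, and \<open>\<phi>\<^sub>1 \<perp> B2\<close> is a subform of
  \<open>\<phi>\<^sub>1 \<otimes> \<phi>\<^sub>2\<close>.
\<close>

lemma tensor_isotropic_of_large_common_part:
  fixes P Q :: "'a::field mat"
  assumes i: "i\<^sup>2 = - (1::'a)" and P: "P \<in> carrier_mat n n" and Q: "Q \<in> carrier_mat m m"
    and nm: "n < m"
    and iso1: "isometric (bilin_quad_tensor (1 # B1) P) (bilin_quad_tensor (1 # C1) Q)"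
    and iso2: "isometric (bilin_quad_tensor (1 # B2) P) (bilin_quad_tensor (1 # C2) Q)"
  shows "isotropic (bilin_quad_tensor (bilin_tensor (1 # B1) (1 # B2)) P)"
proof -
  note carP = bilin_quad_tensor_carrier[OF P] and carQ = bilin_quad_tensor_carrier[OF Q]
  let ?X = "bilin_quad_tensor (1 # B1) P" and ?Y = "bilin_quad_tensor B2 P"
  define N1 where "N1 = length (1 # B1) * n"
  define N2 where "N2 = length B2 * n"
  have X: "?X \<in> carrier_mat N1 N1" and Y: "?Y \<in> carrier_mat N2 N2"
    unfolding N1_def N2_def by (rule carP)+
  obtain G where G: "G \<in> carrier_mat N1 m"
    and kG: "\<And>x. x \<in> carrier_vec m \<Longrightarrow> G *\<^sub>v x = 0\<^sub>v N1 \<Longrightarrow> x = 0\<^sub>v m"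
    and vG: "\<And>x. x \<in> carrier_vec m \<Longrightarrow> qf_value ?X (G *\<^sub>v x) = qf_value Q x"
    using isometric_orth_sum_embedding[OF _ Q carQ X] iso1
    unfolding bilin_quad_tensor_Cons[of 1 C1] one_smult_mat by blast
  have split: "bilin_quad_tensor (1 # B2) P = orth_sum P ?Y"
    by (simp add: bilin_quad_tensor_Cons)
  obtain K where K: "K \<in> carrier_mat (n + N2) m"
    and vK: "\<And>x. x \<in> carrier_vec m \<Longrightarrow> qf_value (orth_sum P ?Y) (K *\<^sub>v x) = qf_value Q x"
    using isometric_orth_sum_embedding[OF _ Q carQ orth_sum_carrier[OF P Y]] iso2
    unfolding bilin_quad_tensor_Cons[of 1 C2] one_smult_mat split by blast
  \<comment> \<open>\<open>H\<close> is the component of \<open>K\<close> in the first summand \<open>P\<close>.\<close>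
  define H where "H = mat n m (\<lambda>(i, j). K $$ (i, j))"
  have H: "H \<in> carrier_mat n m" unfolding H_def by simp
  have HK: "H *\<^sub>v x = vec_first (K *\<^sub>v x) n" if "x \<in> carrier_vec m" for x
  proof (rule eq_vecI)
    fix j assume "j < dim_vec (vec_first (K *\<^sub>v x) n)"
    then have j: "j < n" by simp
    then have "row H j = row K j" using K by (intro eq_vecI) (auto simp: H_def)
    then show "vec_index (H *\<^sub>v x) j = vec_index (vec_first (K *\<^sub>v x) n) j"
      using j K H by (simp add: vec_first_def)
  qed (use H in simp)
  obtain x where x: "x \<in> carrier_vec m" "x \<noteq> 0\<^sub>v m" "H *\<^sub>v x = 0\<^sub>v n"
    using exists_kernel_vec[OF H nm] by blast
  define y where "y = vec_last (K *\<^sub>v x) N2"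
  have y: "y \<in> carrier_vec N2" unfolding y_def by simp
  have "K *\<^sub>v x \<in> carrier_vec (n + N2)" using K x by auto
  from vec_first_last_append[OF this] have Kx: "K *\<^sub>v x = 0\<^sub>v n @\<^sub>v y"
    using HK[OF x(1)] x(3) unfolding y_def by simp
  have Gx: "G *\<^sub>v x \<in> carrier_vec N1" using G x by auto
  have "qf_value ?Y y = qf_value Q x"
    using vK[OF x(1)] unfolding Kx using P by (simp add: qf_value_orth_sum[OF P Y _ y])
  then have "qf_value (orth_sum ?X ?Y) ((G *\<^sub>v x) @\<^sub>v (i \<cdot>\<^sub>v y)) = 0"
    using qf_value_orth_sum[OF X Y Gx, of "i \<cdot>\<^sub>v y"] y vG[OF x(1)] i
    by (simp add: qf_value_smult_vec[OF Y])
  moreover have "(G *\<^sub>v x) @\<^sub>v (i \<cdot>\<^sub>v y) \<noteq> 0\<^sub>v (N1 + N2)"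
    using kG[OF x(1)] x(2) by (auto simp: append_vec_zero_iff[OF Gx])
  moreover have "(G *\<^sub>v x) @\<^sub>v (i \<cdot>\<^sub>v y) \<in> carrier_vec (N1 + N2)" using Gx y by auto
  ultimately have "isotropic (orth_sum ?X ?Y)"
    unfolding isotropic_def carrier_matD(1)[OF orth_sum_carrier[OF X Y]] by blast
  then have "isotropic (orth_sum (orth_sum ?X ?Y) (bilin_quad_tensor (bilin_tensor B1 B2) P))"
    by (rule isotropic_orth_sum[OF orth_sum_carrier[OF X Y] carP])
  then have "isotropic (bilin_quad_tensor ((1 # B1 @ B2) @ bilin_tensor B1 B2) P)"
    by (simp only: append_Cons[symmetric] bilin_quad_tensor_append)
  then show ?thesis
    by (rule isotropic_isometric) (rule bilin_quad_tensor_permute[OF P mset_bilin_tensor_one[symmetric]])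
qed

section \<open>Quadratic Pfister forms in all characteristics\<close>

text \<open>
  The innermost factor of a quadratic Pfister form. Singling it out turns both definitions of an
  \<open>n\<close>-fold form, according to the characteristic, into a product with a bilinear
  \<open>(n - 1)\<close>-fold Pfister form.
\<close>

definition pfister_plane :: "'a::field mat \<Rightarrow> bool" where
  "pfister_plane N \<longleftrightarrow> (if CHAR('a) = 2 then \<exists>b. N = binary_quad b
     else \<exists>a. a \<noteq> 0 \<and> N = diag_quad [1, - a])"

lemma two_eq_zero_iff_CHAR: "(2::'a::field) = 0 \<longleftrightarrow> CHAR('a) = 2"
proof
  assume "(2::'a) = 0"
  then have "CHAR('a) dvd 2" using of_nat_eq_0_iff_char_dvd[of 2, where ?'a = 'a] by simp
  then have "CHAR('a) \<le> 2" "CHAR('a) \<noteq> 0" by (auto dest: dvd_imp_le intro: ccontr)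
  moreover have "CHAR('a) \<noteq> 1" by (simp add: CHAR_not_1')
  ultimately show "CHAR('a) = 2" by linarith
next
  assume "CHAR('a) = 2"
  then show "(2::'a) = 0" by (metis of_nat_CHAR of_nat_numeral)
qed

lemma diag_quad_tensor: "diag_quad B = bilin_quad_tensor B (mat_of_rows_list 1 [[1]])"
proof -
  have "b \<cdot>\<^sub>m mat_of_rows_list 1 [[1]] = mat_of_rows_list 1 [[b]]" for b :: 'a
    by (rule eq_matI) (auto simp: mat_of_rows_list_def)
  then show ?thesis unfolding diag_quad_def bilin_quad_tensor_def by simp
qed

lemma diag_quad_pair: "diag_quad [a, b] = plane_mat a 0 0 b"
  unfolding diag_quad_def plane_mat_def
  by (rule eq_matI) (auto simp: mat_of_rows_list_def Let_def less_2_cases_iff less_Suc_eq)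

text \<open>
  The discriminant \<open>s\<^sup>2 - 4 a\<close> is \<open>1\<close> in characteristic two and \<open>4 b\<close> for \<open>\<langle>1, -b\<rangle>\<close> otherwise.
\<close>

lemma pfister_plane_norm_plane:
  fixes N :: "'a::field mat"
  assumes "pfister_plane N"
  obtains s a where "N = norm_plane s a" "s\<^sup>2 \<noteq> 4 * a"
proof (cases "CHAR('a) = 2")
  case True
  then obtain b where "N = binary_quad b" using assms unfolding pfister_plane_def by auto
  then have N: "N = norm_plane 1 b" unfolding binary_quad_def plane_mat_def by simp
  have "(4::'a) = 2 * 2" by simp
  also have "\<dots> = 0" using True two_eq_zero_iff_CHAR[where ?'a = 'a] by simp
  finally show thesis using that[OF N] by simp
next
  case False
  then obtain b where b: "b \<noteq> 0" "N = diag_quad [1, - b]" using assms unfolding pfister_plane_def by auto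
  have "(2::'a) \<noteq> 0" using False two_eq_zero_iff_CHAR[where ?'a = 'a] by simp
  then have "(2::'a) * 2 \<noteq> 0" by (metis mult_eq_0_iff)
  then have "(4::'a) \<noteq> 0" by simp
  with b that[of 0 "- b"] show thesis by (simp add: diag_quad_pair)
qed

lemma quadratic_pfister_iff:
  fixes Q :: "'a::field mat"
  shows "quadratic_pfister n Q \<longleftrightarrow> n \<ge> 1 \<and> (\<exists>as N. length as = n - 1 \<and> 0 \<notin> set as \<and>
    pfister_plane N \<and> isometric Q (pfister_form as N))"
proof (cases "CHAR('a) = 2")
  case True
  then show ?thesis unfolding quadratic_pfister_def pfister_plane_def by auto
next
  case False
  \<comment> \<open>The last slot of the diagonal form becomes the binary factor.\<close>
  have tens: "diag_quad (pfister_diag (as @ [a])) = pfister_form as (diag_quad [1, - a])"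
    for as and a :: 'a
    by (simp only: diag_quad_tensor pfister_diag_append pfister_diag_singleton bilin_quad_tensor_assoc)
  have "(\<exists>as. length as = n \<and> 0 \<notin> set as \<and> isometric Q (diag_quad (pfister_diag as))) \<longleftrightarrow>
     (\<exists>as N. length as = n - 1 \<and> 0 \<notin> set as \<and> (\<exists>a. a \<noteq> 0 \<and> N = diag_quad [1, - a]) \<and>
       isometric Q (pfister_form as N))" (is "?L \<longleftrightarrow> ?R") if n: "n \<ge> 1"
  proof
    assume ?L
    then obtain as where as: "length as = n" "0 \<notin> set as" "isometric Q (diag_quad (pfister_diag as))"
      by blast
    then obtain bs b where "as = bs @ [b]" using n by (cases as rule: rev_cases) auto
    then show ?R using as by (intro exI[of _ bs] exI[of _ "diag_quad [1, - b]"]) (auto simp: tens)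
  next
    assume ?R
    then obtain as a where "length as = n - 1" "0 \<notin> set as" "a \<noteq> 0"
      "isometric Q (pfister_form as (diag_quad [1, - a]))" by blast
    then show ?L using n by (intro exI[of _ "as @ [a]"]) (auto simp: tens)
  qed
  then show ?thesis using False unfolding quadratic_pfister_def pfister_plane_def by auto
qed

lemma pfister_plane_carrier: "pfister_plane N \<Longrightarrow> N \<in> carrier_mat 2 2"
  by (metis pfister_plane_norm_plane plane_mat_carrier)

lemma quadratic_pfister_carrier:
  assumes "quadratic_pfister n Q"
  shows "Q \<in> carrier_mat (2 ^ n) (2 ^ n)"
proof -
  from assms obtain as N where n: "n \<ge> 1" "length as = n - 1" and N: "pfister_plane N"
    and iso: "isometric Q (pfister_form as N)" unfolding quadratic_pfister_iff by blast
  have "length (pfister_diag as) * 2 = 2 ^ n"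
    using n by (cases n) (simp_all add: length_pfister_diag)
  then have "pfister_form as N \<in> carrier_mat (2 ^ n) (2 ^ n)"
    using bilin_quad_tensor_carrier[OF pfister_plane_carrier[OF N], of "pfister_diag as"] by metis
  with isometric_sym[OF iso] show ?thesis by (rule isometric_dims)
qed

lemma quadratic_pfister_isotropic_imp_hyperbolic:
  assumes "quadratic_pfister n Q" "isotropic Q"
  shows "hyperbolic Q"
proof -
  from assms obtain as N where as: "0 \<notin> set as" and N: "pfister_plane N"
    and iso: "isometric Q (pfister_form as N)" unfolding quadratic_pfister_iff by blast
  obtain s a where sa: "N = norm_plane s a" "s\<^sup>2 \<noteq> 4 * a" using pfister_plane_norm_plane[OF N] .
  have "isotropic (pfister_form as N)" using isotropic_isometric[OF assms(2) iso] .
  then have "hyperbolic (pfister_form as N)" using pfister_form_properties[OF sa(2) as] sa(1) by blast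
  with iso show ?thesis by (rule hyperbolic_isometric)
qed

lemma quadratic_pfister_tensor:
  assumes "0 \<notin> set as" "quadratic_pfister n Q"
  shows "quadratic_pfister (length as + n) (pfister_form as Q)"
proof -
  from assms obtain bs N where bs: "n \<ge> 1" "length bs = n - 1" "0 \<notin> set bs" "pfister_plane N"
    and iso: "isometric Q (pfister_form bs N)" unfolding quadratic_pfister_iff by blast
  have "isometric (pfister_form as Q) (pfister_form (as @ bs) N)"
    using bilin_quad_tensor_cong[OF iso] by (simp only: pfister_diag_append bilin_quad_tensor_assoc)
  then show ?thesis unfolding quadratic_pfister_iff
    using bs assms(1) by (intro conjI exI[of _ "as @ bs"] exI[of _ N]) auto
qed

text \<open>
  Only for \<open>n \<ge> 1\<close> is there a bilinear slot that can be split off: the innermost factor is quadratic.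
\<close>

lemma quadratic_pfister_Suc_factor:
  assumes "quadratic_pfister (Suc n) Q" "n \<ge> 1"
  obtains a P where "a \<noteq> 0" "quadratic_pfister n P" "isometric Q (bilin_quad_tensor [1, - a] P)"
proof -
  from assms obtain as N where as: "length as = n" "0 \<notin> set as" "pfister_plane N"
    and iso: "isometric Q (pfister_form as N)" unfolding quadratic_pfister_iff by auto
  from as assms(2) obtain a bs where abs: "as = a # bs" by (cases as) auto
  show thesis
  proof (rule that)
    show "a \<noteq> 0" using as abs by auto
    show "quadratic_pfister n (pfister_form bs N)" unfolding quadratic_pfister_iff
      using as abs assms(2) isometric_refl[OF bilin_quad_tensor_carrier[OF pfister_plane_carrier]]
      by (intro conjI exI[of _ bs] exI[of _ N]) auto
    show "isometric Q (bilin_quad_tensor [1, - a] (pfister_form bs N))"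
      using iso unfolding abs by (simp only: pfister_diag.simps bilin_quad_tensor_assoc)
  qed
qed

section \<open>Linkage and triviality of the invariant\<close>

text \<open>
  One bilinear slot of the common factor moves into both cofactors.
\<close>

lemma linked_Suc_imp_linked:
  assumes "linked (Suc k) Q1 Q2" "k \<ge> 1"
  shows "linked k Q1 Q2"
proof -
  from assms(1) obtain Q C1 C2 where Q: "quadratic_pfister (Suc k) Q"
    and C: "bilinear_pfister C1" "bilinear_pfister C2"
    and iso: "isometric Q1 (bilin_quad_tensor C1 Q)" "isometric Q2 (bilin_quad_tensor C2 Q)"
    unfolding linked_def common_factor_def by blast
  obtain a P where a: "a \<noteq> 0" and P: "quadratic_pfister k P"
    and Qi: "isometric Q (bilin_quad_tensor [1, - a] P)"
    by (rule quadratic_pfister_Suc_factor[OF Q assms(2)])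
  have bp: "bilinear_pfister (bilin_tensor C [1, - a])" if C: "bilinear_pfister C" for C
  proof -
    from C obtain cs where cs: "0 \<notin> set cs" "C = pfister_diag cs" unfolding bilinear_pfister_def by blast
    then show ?thesis unfolding bilinear_pfister_def
      using a by (intro exI[of _ "cs @ [a]"])
        (auto simp: pfister_diag_append pfister_diag_singleton simp del: pfister_diag.simps)
  qed
  have "isometric R (bilin_quad_tensor (bilin_tensor C [1, - a]) P)"
    if "isometric R (bilin_quad_tensor C Q)" for R C
    using isometric_trans[OF that bilin_quad_tensor_cong[OF Qi]] unfolding bilin_quad_tensor_assoc .
  then show ?thesis
    using iso P bp[OF C(1)] bp[OF C(2)] unfolding linked_def common_factor_def by blast
qed

theorem theorem5p1:
  fixes \<psi>1 \<psi>2 :: "'a::field mat" and k n1 n2 :: nat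
  assumes "\<exists>i::'a. i \<noteq> 0 \<and> i\<^sup>2 = - 1"
    and "k \<ge> 1"
    and "quadratic_pfister n1 \<psi>1" and "quadratic_pfister n2 \<psi>2"
    and "linked (k + 1) \<psi>1 \<psi>2"
  shows "(\<exists>\<phi>. is_k_invariant k \<psi>1 \<psi>2 \<phi>) \<and>
         (\<forall>\<phi>. is_k_invariant k \<psi>1 \<psi>2 \<phi> \<longrightarrow> hyperbolic \<phi>)"
proof (intro conjI allI impI)
  have "linked k \<psi>1 \<psi>2" using linked_Suc_imp_linked assms(2,5) by simp
  then obtain P B1 B2 where cf: "common_factor k \<psi>1 \<psi>2 P B1 B2" unfolding linked_def by blast
  then have "P \<in> carrier_mat (2 ^ k) (2 ^ k)"
    using quadratic_pfister_carrier unfolding common_factor_def by blast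
  from isometric_refl[OF bilin_quad_tensor_carrier[OF this]] cf
  show "\<exists>\<phi>. is_k_invariant k \<psi>1 \<psi>2 \<phi>" unfolding is_k_invariant_def by blast
next
  fix \<phi> assume "is_k_invariant k \<psi>1 \<psi>2 \<phi>"
  then obtain P B1 B2 where P: "quadratic_pfister k P"
    and B: "bilinear_pfister B1" "bilinear_pfister B2"
    and isoB: "isometric \<psi>1 (bilin_quad_tensor B1 P)" "isometric \<psi>2 (bilin_quad_tensor B2 P)"
    and \<phi>: "isometric \<phi> (bilin_quad_tensor (bilin_tensor B1 B2) P)"
    unfolding is_k_invariant_def common_factor_def by blast
  from assms(5) obtain Q C1 C2 where Q: "quadratic_pfister (k + 1) Q"
    and C: "bilinear_pfister C1" "bilinear_pfister C2"
    and isoC: "isometric \<psi>1 (bilin_quad_tensor C1 Q)" "isometric \<psi>2 (bilin_quad_tensor C2 Q)"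
    unfolding linked_def common_factor_def by blast
  from assms(1) obtain i :: 'a where i: "i\<^sup>2 = - 1" by blast
  from B obtain bs1 bs2 where bs: "0 \<notin> set bs1" "0 \<notin> set bs2"
    and Bd: "B1 = pfister_diag bs1" "B2 = pfister_diag bs2" unfolding bilinear_pfister_def by blast
  obtain B1' B2' C1' C2' where hd: "B1 = 1 # B1'" "B2 = 1 # B2'" "C1 = 1 # C1'" "C2 = 1 # C2'"
    using B C pfister_diag_hd unfolding bilinear_pfister_def by metis
  have "isotropic (bilin_quad_tensor (bilin_tensor B1 B2) P)"
    unfolding hd
  proof (rule tensor_isotropic_of_large_common_part[OF i quadratic_pfister_carrier[OF P]
        quadratic_pfister_carrier[OF Q]])
    show "isometric (bilin_quad_tensor (1 # B1') P) (bilin_quad_tensor (1 # C1') Q)"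
      "isometric (bilin_quad_tensor (1 # B2') P) (bilin_quad_tensor (1 # C2') Q)"
      using isometric_trans[OF isometric_sym[OF isoB(1)] isoC(1)]
        isometric_trans[OF isometric_sym[OF isoB(2)] isoC(2)] unfolding hd .
  qed simp
  moreover have "quadratic_pfister (length (bs1 @ bs2) + k) (bilin_quad_tensor (bilin_tensor B1 B2) P)"
    using quadratic_pfister_tensor[OF _ P, of "bs1 @ bs2"] bs unfolding Bd pfister_diag_append by simp
  ultimately have "hyperbolic (bilin_quad_tensor (bilin_tensor B1 B2) P)"
    using quadratic_pfister_isotropic_imp_hyperbolic by blast
  with \<phi> show "hyperbolic \<phi>" by (rule hyperbolic_isometric)
qed

end
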